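(* Let $f:\mathbb{N}\to\mathbb{N}$ be a function with $f(n)\in \log^{\omega(1)} n$ and let $p$ be a prime. There is no $\mathrm{FO}+\mathrm{Mod}\,p$ formula with access to (arbitrary) built-in relations that defines (a) whether the size of a unary relation $U$ with $|U|\le f(n)$ is divisible by $q$, for any prime $q$ distinct from $p$ (here $n$ is the size of the domain); (b) reachability in graphs with at most $f(n)$ edges (where $n$ is the number of nodes), even when restricted to graphs that are disjoint unions of paths.
   Context: $\mathrm{FO}+\mathrm{Mod}\,p$ denotes first-order logic extended by modulo-$p$ counting quantifiers (a quantifier $\exists^{\equiv 0 \bmod p} x\,\varphi$ expressing that the number of witnesses $x$ of $\varphi$ is divisible by $p$). "Access to built-in relations" means the formula may additionally use arbitrary fixed relations on the domain $\{0,\dots,n-1\}$ that depend only on $n$ (i.e. non-uniformly). "Defines reachability" means a formula $\varphi(s,t)$ over the edge relation $E$ (plus built-in relations) such that for every admissible graph, $\varphi(s,t)$ holds iff there is a directed path from $s$ to $t$. *)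

theory Defs
  imports Complex_Main "HOL-Computational_Algebra.Primes"
begin

definition in_log_pow_omega_1 :: "(nat \<Rightarrow> nat) \<Rightarrow> bool" where
  "in_log_pow_omega_1 f \<longleftrightarrow>
    (\<exists>g :: nat \<Rightarrow> real. filterlim g at_top sequentially \<and>
      (\<forall>\<^sub>F n in sequentially. real (f n) = log 2 (real n) powr g n))"

text \<open>
  The modulus of the counting quantifier \<open>ExMod\<close> is not part of the syntax: it is the
  parameter \<open>p\<close> of the satisfaction relation \<open>sat\<close>, in which \<open>{..<n}\<close> is the domain.
\<close>

datatype 'r fm =
    Eq nat nat
  | Rel 'r "nat list"
  | Neg "'r fm"
  | Conj "'r fm" "'r fm"
  | Ex nat "'r fm"
  | ExMod nat "'r fm"

fun well_formed :: "('r \<Rightarrow> nat) \<Rightarrow> 'r fm \<Rightarrow> bool" where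
  "well_formed ar (Eq x y) \<longleftrightarrow> True"
| "well_formed ar (Rel r xs) \<longleftrightarrow> length xs = ar r"
| "well_formed ar (Neg \<phi>) \<longleftrightarrow> well_formed ar \<phi>"
| "well_formed ar (Conj \<phi> \<psi>) \<longleftrightarrow> well_formed ar \<phi> \<and> well_formed ar \<psi>"
| "well_formed ar (Ex x \<phi>) \<longleftrightarrow> well_formed ar \<phi>"
| "well_formed ar (ExMod x \<phi>) \<longleftrightarrow> well_formed ar \<phi>"

fun free_vars :: "'r fm \<Rightarrow> nat set" where
  "free_vars (Eq x y) = {x, y}"
| "free_vars (Rel r xs) = set xs"
| "free_vars (Neg \<phi>) = free_vars \<phi>"
| "free_vars (Conj \<phi> \<psi>) = free_vars \<phi> \<union> free_vars \<psi>"
| "free_vars (Ex x \<phi>) = free_vars \<phi> - {x}"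
| "free_vars (ExMod x \<phi>) = free_vars \<phi> - {x}"

fun sat :: "nat \<Rightarrow> nat \<Rightarrow> ('r \<Rightarrow> nat list set) \<Rightarrow> (nat \<Rightarrow> nat) \<Rightarrow> 'r fm \<Rightarrow> bool" where
  "sat p n I v (Eq x y) \<longleftrightarrow> v x = v y"
| "sat p n I v (Rel r xs) \<longleftrightarrow> map v xs \<in> I r"
| "sat p n I v (Neg \<phi>) \<longleftrightarrow> \<not> sat p n I v \<phi>"
| "sat p n I v (Conj \<phi> \<psi>) \<longleftrightarrow> sat p n I v \<phi> \<and> sat p n I v \<psi>"
| "sat p n I v (Ex x \<phi>) \<longleftrightarrow> (\<exists>a<n. sat p n I (v(x := a)) \<phi>)"
| "sat p n I v (ExMod x \<phi>) \<longleftrightarrow> p dvd card {a. a < n \<and> sat p n I (v(x := a)) \<phi>}"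

datatype sym = Input | Builtin nat

fun arity :: "nat \<Rightarrow> (nat \<Rightarrow> nat) \<Rightarrow> sym \<Rightarrow> nat" where
  "arity k ar Input = k"
| "arity k ar (Builtin i) = ar i"

fun interp :: "nat list set \<Rightarrow> (nat \<Rightarrow> nat list set) \<Rightarrow> sym \<Rightarrow> nat list set" where
  "interp R B Input = R"
| "interp R B (Builtin i) = B i"

text \<open>
  In what follows, \<open>ar i\<close> is the arity of the \<open>i\<close>-th built-in symbol and \<open>B n i\<close> its interpretation
  over the domain \<open>{..<n}\<close>. No condition is imposed on \<open>B\<close>: a well-formed formula
  evaluated under an assignment into the domain only inspects \<open>B n i\<close> on \<open>ar i\<close>-tuples
  over the domain.
\<close>

definition defines_divisibility ::
  "nat \<Rightarrow> (nat \<Rightarrow> nat) \<Rightarrow> nat \<Rightarrow> (nat \<Rightarrow> nat) \<Rightarrow> (nat \<Rightarrow> nat \<Rightarrow> nat list set) \<Rightarrow> sym fm \<Rightarrow> bool" where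
  "defines_divisibility p f q ar B \<phi> \<longleftrightarrow>
    well_formed (arity 1 ar) \<phi> \<and> free_vars \<phi> = {} \<and>
    (\<forall>n U v. n > 0 \<and> U \<subseteq> {..<n} \<and> card U \<le> f n \<and> range v \<subseteq> {..<n} \<longrightarrow>
      (sat p n (interp {[a] | a. a \<in> U} (B n)) v \<phi> \<longleftrightarrow> q dvd card U))"

text \<open>
  \<open>G n E\<close> says that the directed graph with nodes \<open>{..<n}\<close> and edge set \<open>E\<close> is
  admissible. The variables \<open>0\<close> and \<open>1\<close> stand for the source and the target.
\<close>

definition defines_reachability ::
  "nat \<Rightarrow> (nat \<Rightarrow> (nat \<times> nat) set \<Rightarrow> bool) \<Rightarrow> (nat \<Rightarrow> nat) \<Rightarrow> (nat \<Rightarrow> nat \<Rightarrow> nat list set) \<Rightarrow> sym fm \<Rightarrow> bool" where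
  "defines_reachability p G ar B \<phi> \<longleftrightarrow>
    well_formed (arity 2 ar) \<phi> \<and> free_vars \<phi> \<subseteq> {0, 1} \<and>
    (\<forall>n E v. n > 0 \<and> E \<subseteq> {..<n} \<times> {..<n} \<and> G n E \<and> range v \<subseteq> {..<n} \<longrightarrow>
      (sat p n (interp {[a, b] | a b. (a, b) \<in> E} (B n)) v \<phi> \<longleftrightarrow> (v 0, v 1) \<in> E\<^sup>*))"

definition path_edges :: "'a list \<Rightarrow> ('a \<times> 'a) set" where
  "path_edges xs = {(xs ! i, xs ! Suc i) | i. Suc i < length xs}"

text \<open>
  Distinctness of \<open>concat ps\<close> says that no path repeats a node and that distinct paths share
  no node. One-element paths are the isolated nodes.
\<close>

definition disjoint_union_of_paths :: "'a set \<Rightarrow> ('a \<times> 'a) set \<Rightarrow> bool" where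
  "disjoint_union_of_paths V E \<longleftrightarrow>
    (\<exists>ps. [] \<notin> set ps \<and> distinct (concat ps) \<and> set (concat ps) = V \<and>
      E = (\<Union>xs\<in>set ps. path_edges xs))"

end

theory Submission
  imports Defs "HOL-Number_Theory.Number_Theory" "HOL-Computational_Algebra.Polynomial"
    "HOL-Library.FuncSet" "HOL-Real_Asymp.Real_Asymp"
begin

text \<open>
  The Razborov--Smolensky method is applied directly to formulas. On inputs \<open>X \<subseteq> V\<close>, every formula
  agrees modulo \<open>p\<close> with an integer polynomial of degree polynomial in \<open>l\<close>, up to a fraction
  \<open>n ^ O(1) / 2 ^ l\<close> of the inputs: an existential quantifier is a disjunction over \<open>n\<close> elements, which is
  detected by \<open>l\<close> subset sums, each halving the number of undetected inputs. With \<open>l = O(log n)\<close> the degree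
  is polylogarithmic. If the formula decided divisibility of \<open>card X + i\<close> by \<open>q\<close>, then \<open>w ^ card X\<close> would
  have a polynomial of this degree \<open>D\<close> on the good inputs, for a root of unity \<open>w\<close> of order \<open>q\<close> in
  characteristic \<open>p\<close>. Hence every function on the good inputs would have degree at most \<open>card V / 2 + D\<close>,
  so that there are too few polynomials once \<open>card V\<close> is large compared with \<open>D\<^sup>2\<close>; this happens already for
  a polylogarithmic \<open>card V\<close>. Reachability in a union of \<open>q\<close> disjoint paths simulates a counter modulo \<open>q\<close>.
\<close>

subsection \<open>Low-degree functions\<close>

text \<open>Polynomials are represented by the functions they induce on subsets, the variables being
  membership bits, and \<open>d\<close> is only an upper bound on the degree. The ring stays
  arbitrary: formulas are approximated over \<open>int\<close>, while the dimension argument runs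
  over \<open>int poly\<close>.\<close>

inductive lowdeg :: "nat \<Rightarrow> ('v set \<Rightarrow> 'a::comm_ring_1) \<Rightarrow> bool" where
  const: "lowdeg 0 (\<lambda>X. c)"
| var: "lowdeg 1 (\<lambda>X. of_bool (i \<in> X))"
| add: "lowdeg d f \<Longrightarrow> lowdeg d g \<Longrightarrow> lowdeg d (\<lambda>X. f X + g X)"
| mult: "lowdeg d f \<Longrightarrow> lowdeg e g \<Longrightarrow> lowdeg (d + e) (\<lambda>X. f X * g X)"
| mono: "lowdeg d f \<Longrightarrow> d \<le> e \<Longrightarrow> lowdeg e f"

lemma lowdeg_const: "lowdeg d (\<lambda>X. c)"
  using lowdeg.const lowdeg.mono by blast

lemma lowdeg_scale: "lowdeg d f \<Longrightarrow> lowdeg d (\<lambda>X. c * f X)"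
  using lowdeg.mult[OF lowdeg.const] by force

lemma lowdeg_diff:
  assumes "lowdeg d f" "lowdeg d g"
  shows "lowdeg d (\<lambda>X. f X - g X)"
  using lowdeg.add[OF assms(1) lowdeg_scale[OF assms(2), of "-1"]] by simp

lemma lowdeg_sum: "(\<And>a. a \<in> A \<Longrightarrow> lowdeg d (f a)) \<Longrightarrow> lowdeg d (\<lambda>X. \<Sum>a\<in>A. f a X)"
  by (induction A rule: infinite_finite_induct) (auto intro: lowdeg_const lowdeg.add)

lemma lowdeg_prod:
  "(\<And>a. a \<in> A \<Longrightarrow> lowdeg d (f a)) \<Longrightarrow> lowdeg (card A * d) (\<lambda>X. \<Prod>a\<in>A. f a X)"
  by (induction A rule: infinite_finite_induct) (auto intro: lowdeg_const lowdeg.mult)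

lemma lowdeg_power: "lowdeg d f \<Longrightarrow> lowdeg (k * d) (\<lambda>X. f X ^ k)"
  by (induction k) (auto intro: lowdeg_const lowdeg.mult)

lemma lowdeg_of_int: "lowdeg d f \<Longrightarrow> lowdeg d (\<lambda>X. of_int (f X))"
  by (induction rule: lowdeg.induct) (auto intro: lowdeg.intros)

lemma lowdeg_if: "lowdeg 1 (\<lambda>X. if i \<in> X then a else b)"
proof -
  have "lowdeg 1 (\<lambda>X. b + (a - b) * of_bool (i \<in> X))"
    by (intro lowdeg.add lowdeg_const lowdeg_scale lowdeg.var)
  also have "(\<lambda>X. b + (a - b) * of_bool (i \<in> X)) = (\<lambda>X. if i \<in> X then a else b)"
    by auto
  finally show ?thesis .
qed

text \<open>Membership bits are idempotent, so the product of the monomials of \<open>S\<close> and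
  \<open>T\<close> is the monomial of \<open>S \<union> T\<close>, and multilinear monomials
  suffice. This normal form makes it possible to count low-degree functions by their
  coefficients.\<close>

lemma lowdeg_imp_monomials:
  assumes "lowdeg d f" "finite V"
  shows "\<exists>c. \<forall>X\<subseteq>V. f X = (\<Sum>T\<in>{T. T \<subseteq> V \<and> card T \<le> d}. c T * of_bool (T \<subseteq> X))"
proof -
  define N where "N = (\<lambda>d f. \<exists>c. \<forall>X\<subseteq>V. f X =
    (\<Sum>T\<in>{T. T \<subseteq> V \<and> card T \<le> d}. c T * of_bool (T \<subseteq> X) :: 'b))"
  have fin: "finite {T. T \<subseteq> V \<and> card T \<le> d}" for d
    using \<open>finite V\<close> by simp
  have add: "N d (\<lambda>X. f X + g X)" if f: "N d f" and g: "N d g" for d f g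
  proof -
    obtain c where "\<forall>X\<subseteq>V. f X = (\<Sum>T\<in>{T. T \<subseteq> V \<and> card T \<le> d}. c T * of_bool (T \<subseteq> X))"
      using f unfolding N_def by blast
    moreover obtain e where "\<forall>X\<subseteq>V. g X = (\<Sum>T\<in>{T. T \<subseteq> V \<and> card T \<le> d}. e T * of_bool (T \<subseteq> X))"
      using g unfolding N_def by blast
    ultimately show ?thesis unfolding N_def
      by (intro exI[of _ "\<lambda>T. c T + e T"]) (simp add: sum.distrib distrib_right del: sum_mult_of_bool_eq)
  qed
  have mon: "N d (\<lambda>X. a * of_bool (S \<subseteq> X))" if "S \<subseteq> V" "card S \<le> d" for d a S
    unfolding N_def
  proof (intro exI[of _ "\<lambda>T. if T = S then a else 0"] allI impI)
    fix X
    have "(\<Sum>T\<in>{T. T \<subseteq> V \<and> card T \<le> d}. (if T = S then a else 0) * of_bool (T \<subseteq> X))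
      = (\<Sum>T\<in>{T. T \<subseteq> V \<and> card T \<le> d}. if T = S then a * of_bool (S \<subseteq> X) else 0)"
      by (intro sum.cong) auto
    also have "\<dots> = a * of_bool (S \<subseteq> X)"
      using that fin by (subst sum.delta) auto
    finally show "a * of_bool (S \<subseteq> X) =
      (\<Sum>T\<in>{T. T \<subseteq> V \<and> card T \<le> d}. (if T = S then a else 0) * of_bool (T \<subseteq> X))" by simp
  qed
  have zero: "N d (\<lambda>X. 0)" for d
    unfolding N_def by (intro exI[of _ "\<lambda>_. 0"]) simp
  have sm: "N d (\<lambda>X. \<Sum>a\<in>A. h a X)" if "\<And>a. a \<in> A \<Longrightarrow> N d (h a)" for d h and A :: "'a set set"
    using that by (induction A rule: infinite_finite_induct) (auto intro: zero add)
  have cong: "N d f" if "N d g" "\<And>X. X \<subseteq> V \<Longrightarrow> f X = g X" for d f g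
    using that unfolding N_def by simp
  have "N d f" using assms(1)
  proof (induction rule: lowdeg.induct)
    case (const c)
    show ?case using mon[of "{}" 0 c] by simp
  next
    case (var i)
    show ?case
    proof (cases "i \<in> V")
      case True
      then show ?thesis using mon[of "{i}" 1 1] by simp
    next
      case False
      then show ?thesis by (intro cong[OF zero]) auto
    qed
  next
    case (add d f g)
    then show ?case using \<open>\<And>d f g. N d f \<Longrightarrow> N d g \<Longrightarrow> N d (\<lambda>X. f X + g X)\<close> by blast
  next
    case (mult d f e g)
    obtain b where b: "\<forall>X\<subseteq>V. f X = (\<Sum>T\<in>{T. T \<subseteq> V \<and> card T \<le> d}. b T * of_bool (T \<subseteq> X))"
      using mult.IH(1) unfolding N_def by blast
    obtain c where c: "\<forall>X\<subseteq>V. g X = (\<Sum>T\<in>{T. T \<subseteq> V \<and> card T \<le> e}. c T * of_bool (T \<subseteq> X))"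
      using mult.IH(2) unfolding N_def by blast
    have "N (d + e) (\<lambda>X. \<Sum>S\<in>{T. T \<subseteq> V \<and> card T \<le> d}. \<Sum>T\<in>{T. T \<subseteq> V \<and> card T \<le> e}.
        b S * c T * of_bool (S \<union> T \<subseteq> X))"
    proof (intro sm mon)
      fix S T assume "S \<in> {T. T \<subseteq> V \<and> card T \<le> d}" "T \<in> {T. T \<subseteq> V \<and> card T \<le> e}"
      then show "S \<union> T \<subseteq> V" "card (S \<union> T) \<le> d + e"
        using card_Un_le[of S T] by auto
    qed
    then show ?case
    proof (rule cong)
      fix X assume "X \<subseteq> V"
      then show "f X * g X = (\<Sum>S\<in>{T. T \<subseteq> V \<and> card T \<le> d}. \<Sum>T\<in>{T. T \<subseteq> V \<and> card T \<le> e}.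
        b S * c T * of_bool (S \<union> T \<subseteq> X))"
        by (simp add: b c sum_product of_bool_conj mult_ac del: sum_mult_of_bool_eq)
    qed
  next
    case (mono d f e)
    then obtain c where c: "\<forall>X\<subseteq>V. f X = (\<Sum>T\<in>{T. T \<subseteq> V \<and> card T \<le> d}. c T * of_bool (T \<subseteq> X))"
      unfolding N_def by blast
    have "N e (\<lambda>X. \<Sum>T\<in>{T. T \<subseteq> V \<and> card T \<le> d}. c T * of_bool (T \<subseteq> X))"
      using \<open>d \<le> e\<close> by (intro sm mon) auto
    then show ?case by (rule cong) (simp add: c)
  qed
  then show ?thesis unfolding N_def .
qed

section \<open>Subset sums that detect witnesses\<close>

text \<open>Toggling the witness \<open>a\<close> pairs up the subsets, and it changes the number of
  witnesses in a subset by exactly one. As \<open>p\<close> never divides two consecutive numbers,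
  at most one member of each pair is counted.\<close>

lemma toggle_bound:
  fixes b :: "nat \<Rightarrow> bool"
  assumes "a < n" "b a" "(p::nat) > 1"
  shows "2 * card {A \<in> Pow {..<n}. p dvd card {a \<in> A. b a}} \<le> 2 ^ n"
proof -
  define Z where "Z = {A \<in> Pow {..<n}. p dvd card {a \<in> A. b a}}"
  define t where "t = (\<lambda>A. if a \<in> A then A - {a} else insert a A)"
  have tt: "t (t A) = A" for A by (auto simp: t_def)
  have inj: "inj t" by (metis injI tt)
  have disj: "Z \<inter> t ` Z = {}"
  proof -
    have "t A \<notin> Z" if "A \<in> Z" for A
    proof -
      define B where "B = {x \<in> A - {a}. b x}"
      have "finite B" "a \<notin> B"
        using that unfolding B_def Z_def by (auto intro: finite_subset[of _ "{..<n}"])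
      moreover have "{x \<in> A. b x} = (if a \<in> A then insert a B else B)"
        using \<open>b a\<close> by (simp add: B_def set_eq_iff) blast
      moreover have "{x \<in> t A. b x} = (if a \<in> A then B else insert a B)"
        using \<open>b a\<close> by (simp add: B_def t_def set_eq_iff) blast
      moreover have "\<not> (p dvd k \<and> p dvd Suc k)" for k
      proof
        assume "p dvd k \<and> p dvd Suc k"
        then have "p dvd Suc k - k" using dvd_diff_nat by blast
        then show False using \<open>p > 1\<close> by simp
      qed
      ultimately have "\<not> (p dvd card {x \<in> A. b x} \<and> p dvd card {x \<in> t A. b x})"
        by auto
      then show ?thesis using that unfolding Z_def by blast
    qed
    then show ?thesis by blast
  qed
  have fin: "finite Z" unfolding Z_def by simp
  have "2 * card Z = card (Z \<union> t ` Z)"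
    using disj fin inj by (simp add: card_Un_disjoint card_image inj_on_subset[OF inj])
  also have "\<dots> \<le> card (Pow {..<n})"
    using \<open>a < n\<close> by (intro card_mono) (auto simp: Z_def t_def split: if_splits)
  finally show ?thesis by (simp add: card_Pow Z_def)
qed

text \<open>Averaging over all subsets \<open>A\<close>: by double counting the pairs of
  \<open>A\<close> and \<open>y\<close>, if every \<open>A\<close> missed more than half of
  \<open>Y\<close>, some \<open>y\<close> would be missed by more than half of the subsets, against
  \<open>toggle_bound\<close>.\<close>

lemma exists_halving_set:
  fixes b :: "'y \<Rightarrow> nat \<Rightarrow> bool"
  assumes "finite Y" "\<And>y. y \<in> Y \<Longrightarrow> \<exists>a<n. b y a" "(p::nat) > 1"
  shows "\<exists>A\<subseteq>{..<n}. 2 * card {y \<in> Y. p dvd card {a \<in> A. b y a}} \<le> card Y"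
proof (rule ccontr)
  assume "\<not> ?thesis"
  then have *: "card Y < 2 * card {y \<in> Y. p dvd card {a \<in> A. b y a}}" if "A \<in> Pow {..<n}" for A
    using that by (auto simp: not_le)
  have "(\<Sum>A\<in>Pow {..<n}. card Y) < (\<Sum>A\<in>Pow {..<n}. 2 * card {y \<in> Y. p dvd card {a \<in> A. b y a}})"
    by (rule sum_strict_mono) (use * in auto)
  also have "\<dots> = 2 * (\<Sum>A\<in>Pow {..<n}. \<Sum>y\<in>Y. of_bool (p dvd card {a \<in> A. b y a}))"
    using assms(1) by (simp add: sum_distrib_left Int_def)
  also have "\<dots> = (\<Sum>y\<in>Y. 2 * card {A \<in> Pow {..<n}. p dvd card {a \<in> A. b y a}})"
    by (subst sum.swap) (simp add: sum_distrib_left Int_def)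
  also have "\<dots> \<le> (\<Sum>y\<in>Y. 2 ^ n)"
  proof (rule sum_mono)
    fix y assume "y \<in> Y"
    then obtain a where "a < n" "b y a" using assms(2) by blast
    then show "2 * card {A \<in> Pow {..<n}. p dvd card {a \<in> A. b y a}} \<le> 2 ^ n"
      using toggle_bound assms(3) by blast
  qed
  finally show False by (simp add: card_Pow mult.commute)
qed

text \<open>Each further set is chosen to halve what the earlier sets left undetected. The sets
  depend on \<open>Y\<close> as a whole and not on its single elements, so one polynomial can use
  them for all inputs.\<close>

lemma exists_halving_sets:
  fixes b :: "'y \<Rightarrow> nat \<Rightarrow> bool"
  assumes "finite Y" "\<And>y. y \<in> Y \<Longrightarrow> \<exists>a<n. b y a" "(p::nat) > 1"
  shows "\<exists>A. (\<forall>j. A j \<subseteq> {..<n}) \<and>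
    card {y \<in> Y. \<forall>j<l. p dvd card {a \<in> A j. b y a}} * 2 ^ l \<le> card Y"
proof (induction l)
  case 0
  show ?case by (rule exI[of _ "\<lambda>_. {}"]) simp
next
  case (Suc l)
  then obtain A where A: "\<forall>j. A j \<subseteq> {..<n}"
    "card {y \<in> Y. \<forall>j<l. p dvd card {a \<in> A j. b y a}} * 2 ^ l \<le> card Y" by blast
  define Y' where "Y' = {y \<in> Y. \<forall>j<l. p dvd card {a \<in> A j. b y a}}"
  obtain A' where A': "A' \<subseteq> {..<n}" "2 * card {y \<in> Y'. p dvd card {a \<in> A'. b y a}} \<le> card Y'"
    using exists_halving_set[of Y' n b p] assms unfolding Y'_def by auto
  have eq: "{y \<in> Y. \<forall>j<Suc l. p dvd card {a \<in> (A(l := A')) j. b y a}}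
    = {y \<in> Y'. p dvd card {a \<in> A'. b y a}}"
    by (auto simp: Y'_def less_Suc_eq)
  have "2 * card {y \<in> Y'. p dvd card {a \<in> A'. b y a}} * 2 ^ l \<le> card Y' * 2 ^ l"
    using A'(2) by (rule mult_le_mono1)
  also have "\<dots> \<le> card Y" using A(2) by (simp add: Y'_def)
  finally show ?case using A A' by (intro exI[of _ "A(l := A')"]) (simp only: eq, auto simp: mult_ac)
qed

subsection \<open>Approximating formulas\<close>

text \<open>Fermat's little theorem turns a counter modulo \<open>p\<close> into a zero test, at the
  cost of a factor \<open>p - 1\<close> in the degree.\<close>

lemma fermat_indicator:
  assumes "prime p" "[z = int c] (mod int p)"
  shows "[z ^ (p - 1) = of_bool (\<not> p dvd c)] (mod int p)"
proof -
  have "[z ^ (p - 1) = int c ^ (p - 1)] (mod int p)"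
    using assms(2) by (rule cong_pow)
  also have "[int c ^ (p - 1) = of_bool (\<not> p dvd c)] (mod int p)"
  proof (cases "p dvd c")
    case True
    have "p - 1 > 0" using prime_gt_1_nat[OF assms(1)] by simp
    then have "int p dvd int c ^ (p - 1)" using True
      by (intro dvd_trans[OF _ dvd_power]) auto
    then show ?thesis using True by (simp add: cong_0_iff)
  next
    case False
    then have "[c ^ (p - 1) = 1] (mod p)" using fermat_theorem assms(1) by blast
    then have "[int (c ^ (p - 1)) = int 1] (mod int p)" by (simp only: cong_int_iff)
    then show ?thesis using False by simp
  qed
  finally show ?thesis .
qed

text \<open>The polynomials have integer values compared modulo \<open>p\<close>, rather than values
  in a prime field, so that \<open>of_int\<close> can later carry them into a quotient ring of
  characteristic \<open>p\<close>.\<close>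

definition mod_errors :: "nat \<Rightarrow> 'v set \<Rightarrow> ('v set \<Rightarrow> bool) \<Rightarrow> ('v set \<Rightarrow> int) \<Rightarrow> 'v set set" where
  "mod_errors p V s P = {X \<in> Pow V. \<not> [P X = of_bool (s X)] (mod int p)}"

lemma finite_mod_errors: "finite V \<Longrightarrow> finite (mod_errors p V s P)"
  by (simp add: mod_errors_def)

lemma cong_sum_indicator:
  assumes "finite A" "\<And>a. a \<in> A \<Longrightarrow> [g a = of_bool (s a)] (mod m)"
  shows "[(\<Sum>a\<in>A. g a) = int (card {a \<in> A. s a})] (mod m)"
proof -
  have "[(\<Sum>a\<in>A. g a) = (\<Sum>a\<in>A. of_bool (s a))] (mod m)"
    by (rule cong_sum) (use assms in auto)
  then show ?thesis using assms(1) by (simp add: Int_def)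
qed

lemma card_UN_mod_errors_le:
  assumes "finite V" "\<And>a. a < n \<Longrightarrow> card (mod_errors p V (s a) (P a)) * L \<le> M"
  shows "card (\<Union>a<n. mod_errors p V (s a) (P a)) * L \<le> n * M"
proof -
  have "card (\<Union>a<n. mod_errors p V (s a) (P a)) * L \<le> (\<Sum>a<n. card (mod_errors p V (s a) (P a))) * L"
    by (intro mult_le_mono1 card_UN_le) simp
  also have "\<dots> \<le> (\<Sum>a<n. M)"
    unfolding sum_distrib_right by (intro sum_mono) (use assms in auto)
  finally show ?thesis by simp
qed

text \<open>Summing the \<open>P a\<close> gives the number of witnesses modulo \<open>p\<close>,
  and \<open>fermat_indicator\<close> tests it for zero. This step is exact, so errors come only
  from the \<open>n\<close> instances.\<close>

lemma approx_ExMod: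
  assumes "prime p" "finite V"
    and deg: "\<And>a. a < n \<Longrightarrow> lowdeg D (P a)"
    and err: "\<And>a. a < n \<Longrightarrow> card (mod_errors p V (s a) (P a)) * L \<le> M"
  shows "\<exists>Q. lowdeg (p * D) Q \<and>
    card (mod_errors p V (\<lambda>X. p dvd card {a. a < n \<and> s a X}) Q) * L \<le> n * M"
proof -
  define Q where "Q = (\<lambda>X. 1 - (\<Sum>a<n. P a X) ^ (p - 1))"
  have "lowdeg ((p - 1) * D) Q" unfolding Q_def
    by (intro lowdeg_diff lowdeg_const lowdeg_power lowdeg_sum) (use deg in auto)
  then have deg_Q: "lowdeg (p * D) Q" by (rule lowdeg.mono) simp
  have "mod_errors p V (\<lambda>X. p dvd card {a. a < n \<and> s a X}) Q \<subseteq>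
    (\<Union>a<n. mod_errors p V (s a) (P a))"
  proof (rule subsetI, rule ccontr)
    fix X assume X: "X \<in> mod_errors p V (\<lambda>X. p dvd card {a. a < n \<and> s a X}) Q"
      "X \<notin> (\<Union>a<n. mod_errors p V (s a) (P a))"
    then have "[(\<Sum>a<n. P a X) = int (card {a \<in> {..<n}. s a X})] (mod int p)"
      by (intro cong_sum_indicator) (auto simp: mod_errors_def)
    then have "[(\<Sum>a<n. P a X) ^ (p - 1) = of_bool (\<not> p dvd card {a \<in> {..<n}. s a X})] (mod int p)"
      using assms(1) fermat_indicator by blast
    then have "[Q X = 1 - of_bool (\<not> p dvd card {a \<in> {..<n}. s a X})] (mod int p)"
      unfolding Q_def by (intro cong_diff cong_refl)
    then have "[Q X = of_bool (p dvd card {a. a < n \<and> s a X})] (mod int p)"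
      by (simp split: if_splits add: of_bool_def)
    then show False using X(1) by (simp add: mod_errors_def)
  qed
  then have "card (mod_errors p V (\<lambda>X. p dvd card {a. a < n \<and> s a X}) Q) * L \<le>
    card (\<Union>a<n. mod_errors p V (s a) (P a)) * L"
    using assms(2) by (intro mult_le_mono1 card_mono) (auto simp: finite_mod_errors)
  also have "\<dots> \<le> n * M" by (rule card_UN_mod_errors_le[OF assms(2) err])
  finally show ?thesis using deg_Q by blast
qed

text \<open>The existential quantifier becomes the disjunction of \<open>l\<close> subset-sum tests.
  New errors occur only at inputs that have a witness missed by all \<open>l\<close> tests, a
  fraction of at most \<open>1 / 2 ^ l\<close>; without a witness every subset sum is zero modulo
  \<open>p\<close>.\<close>

lemma approx_Ex:
  assumes "prime p" "finite V"
    and deg: "\<And>a. a < n \<Longrightarrow> lowdeg D (P a)"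
    and err: "\<And>a. a < n \<Longrightarrow> card (mod_errors p V (s a) (P a)) * 2 ^ l \<le> M"
  shows "\<exists>Q. lowdeg (l * (p * D)) Q \<and>
    card (mod_errors p V (\<lambda>X. \<exists>a<n. s a X) Q) * 2 ^ l \<le> n * M + 2 ^ card V"
proof -
  define Y where "Y = {X \<in> Pow V. \<exists>a<n. s a X}"
  have finY: "finite Y" using assms(2) by (simp add: Y_def)
  have "\<exists>A. (\<forall>j. A j \<subseteq> {..<n}) \<and>
      card {X \<in> Y. \<forall>j<l. p dvd card {a \<in> A j. s a X}} * 2 ^ l \<le> card Y"
    using finY prime_gt_1_nat[OF assms(1)] by (intro exists_halving_sets) (auto simp: Y_def)
  then obtain A where A: "\<And>j. A j \<subseteq> {..<n}"
    "card {X \<in> Y. \<forall>j<l. p dvd card {a \<in> A j. s a X}} * 2 ^ l \<le> card Y"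
    by blast
  define Z where "Z = {X \<in> Y. \<forall>j<l. p dvd card {a \<in> A j. s a X}}"
  \<comment> \<open>Each factor is 1 modulo \<open>p\<close> if the \<open>j\<close>-th test detects
    nothing and 0 otherwise, so the product is the indicator that all tests fail.\<close>
  define Q where "Q = (\<lambda>X. 1 - (\<Prod>j<l. 1 - (\<Sum>a\<in>A j. P a X) ^ (p - 1)))"
  have finA: "finite (A j)" for j using A(1) finite_subset by blast
  have "lowdeg (card {..<l} * ((p - 1) * D)) Q" unfolding Q_def
    by (intro lowdeg_diff lowdeg_const lowdeg_prod lowdeg_power lowdeg_sum)
      (use deg A(1) in auto)
  then have deg_Q: "lowdeg (l * (p * D)) Q" by (rule lowdeg.mono) simp
  have "mod_errors p V (\<lambda>X. \<exists>a<n. s a X) Q \<subseteq>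
    (\<Union>a<n. mod_errors p V (s a) (P a)) \<union> Z"
  proof (rule subsetI, rule ccontr)
    fix X assume X: "X \<in> mod_errors p V (\<lambda>X. \<exists>a<n. s a X) Q"
      "X \<notin> (\<Union>a<n. mod_errors p V (s a) (P a)) \<union> Z"
    then have "X \<subseteq> V" by (simp add: mod_errors_def)
    then have good: "\<And>a. a \<in> {..<n} \<Longrightarrow> [P a X = of_bool (s a X)] (mod int p)"
      using X(2) unfolding mod_errors_def by blast
    have *: "[1 - (\<Sum>a\<in>A j. P a X) ^ (p - 1) = of_bool (p dvd card {a \<in> A j. s a X})] (mod int p)" for j
    proof -
      have "[(\<Sum>a\<in>A j. P a X) = int (card {a \<in> A j. s a X})] (mod int p)"
        using good A(1)[of j] by (intro cong_sum_indicator finA) blast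
      then have "[1 - (\<Sum>a\<in>A j. P a X) ^ (p - 1) = 1 - of_bool (\<not> p dvd card {a \<in> A j. s a X})] (mod int p)"
        using assms(1) by (intro cong_diff cong_refl fermat_indicator)
      then show ?thesis by (simp split: if_splits add: of_bool_def)
    qed
    have "[Q X = 1 - (\<Prod>j<l. of_bool (p dvd card {a \<in> A j. s a X}))] (mod int p)"
      unfolding Q_def by (intro cong_diff cong_refl cong_prod *)
    moreover have "(\<Prod>j<l. of_bool (p dvd card {a \<in> A j. s a X})) = (1 - of_bool (\<exists>a<n. s a X) :: int)"
    proof (cases "\<exists>a<n. s a X")
      case True
      then have "\<exists>j<l. \<not> p dvd card {a \<in> A j. s a X}"
        using X(2) \<open>X \<subseteq> V\<close> by (auto simp: Z_def Y_def)
      then show ?thesis using True by auto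
    next
      case False
      then have "{a \<in> A j. s a X} = {}" for j using A(1)[of j] by auto
      then have "card {a \<in> A j. s a X} = 0" for j by (simp only: card.empty)
      then show ?thesis by (simp add: False)
    qed
    ultimately show False using X(1) by (simp add: mod_errors_def)
  qed
  then have "card (mod_errors p V (\<lambda>X. \<exists>a<n. s a X) Q) * 2 ^ l \<le>
    card ((\<Union>a<n. mod_errors p V (s a) (P a)) \<union> Z) * 2 ^ l"
    using assms(2) finY by (intro mult_le_mono1 card_mono) (auto simp: finite_mod_errors Z_def)
  also have "\<dots> \<le> (card (\<Union>a<n. mod_errors p V (s a) (P a)) + card Z) * 2 ^ l"
    by (intro mult_le_mono1 card_Un_le)
  also have "\<dots> \<le> n * M + 2 ^ card V"
  proof -
    have "card Y \<le> card (Pow V)" using assms(2) unfolding Y_def by (intro card_mono) auto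
    then have "card Z * 2 ^ l \<le> 2 ^ card V" using A(2) assms(2) by (simp add: Z_def card_Pow)
    then show ?thesis using card_UN_mod_errors_le[OF assms(2) err]
      by (simp add: add_mult_distrib add_mono)
  qed
  finally show ?thesis using deg_Q by blast
qed

text \<open>The four constants precede the quantifiers over \<open>n\<close>, \<open>l\<close>,
  \<open>V\<close>, \<open>R\<close>, \<open>B\<close> and \<open>v\<close>: they depend only on the
  formula and on \<open>p\<close>. Under a fixed assignment a built-in atom is a constant, which is
  why arbitrary built-in relations do no harm. The hypothesis on \<open>R\<close> is all that is
  asked of the encoding of \<open>X\<close> in the input relation.\<close>

lemma approx_formula:
  assumes "prime p"
  shows "\<exists>C d K k. \<forall>n l V R B v. n \<ge> 1 \<longrightarrow> l \<ge> 1 \<longrightarrow> finite V \<longrightarrow>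
    (\<forall>t. lowdeg 1 (\<lambda>X. of_bool (t \<in> R X) :: int)) \<longrightarrow>
    (\<exists>P. lowdeg (C * l ^ d) P \<and>
      card (mod_errors p V (\<lambda>X. sat p n (interp (R X) B) v \<phi>) P) * 2 ^ l \<le> K * n ^ k * 2 ^ card V)"
    (is "\<exists>C d K k. ?A \<phi> C d K k")
proof (induction \<phi>)
  case (Eq x y)
  \<comment> \<open>Atoms are represented without error, hence \<open>K = 0\<close>.\<close>
  have "?A (Eq x y) 1 0 0 0"
  proof (intro allI impI)
    fix n l :: nat and V :: "'a set" and R :: "'a set \<Rightarrow> nat list set" and B :: "nat \<Rightarrow> nat list set" and v :: "nat \<Rightarrow> nat"
    show "\<exists>P. lowdeg (1 * l ^ 0) P \<and>
      card (mod_errors p V (\<lambda>X. sat p n (interp (R X) B) v (Eq x y)) P) * 2 ^ l \<le> 0 * n ^ 0 * 2 ^ card V"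
      by (intro exI[of _ "\<lambda>X. of_bool (v x = v y)"])
        (auto intro: lowdeg_const simp: mod_errors_def)
  qed
  then show ?case by blast
next
  case (Rel r xs)
  have "?A (Rel r xs) 1 0 0 0"
  proof (intro allI impI)
    fix n l :: nat and V :: "'a set" and R :: "'a set \<Rightarrow> nat list set" and B :: "nat \<Rightarrow> nat list set" and v :: "nat \<Rightarrow> nat"
    assume R: "\<forall>t. lowdeg 1 (\<lambda>X. of_bool (t \<in> R X) :: int)"
    have "lowdeg 1 (\<lambda>X. of_bool (map v xs \<in> interp (R X) B r) :: int)"
      using R by (cases r) (auto intro: lowdeg_const)
    then show "\<exists>P. lowdeg (1 * l ^ 0) P \<and>
      card (mod_errors p V (\<lambda>X. sat p n (interp (R X) B) v (Rel r xs)) P) * 2 ^ l \<le> 0 * n ^ 0 * 2 ^ card V"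
      by (intro exI[of _ "\<lambda>X. of_bool (map v xs \<in> interp (R X) B r)"])
        (auto simp: mod_errors_def)
  qed
  then show ?case by blast
next
  case (Neg \<phi>)
  then obtain C d K k where IH: "?A \<phi> C d K k" by blast
  have "?A (Neg \<phi>) C d K k"
  proof (intro allI impI)
    fix n l :: nat and V :: "'a set" and R :: "'a set \<Rightarrow> nat list set" and B :: "nat \<Rightarrow> nat list set" and v :: "nat \<Rightarrow> nat"
    assume a: "n \<ge> 1" "l \<ge> 1" "finite V" "\<forall>t. lowdeg 1 (\<lambda>X. of_bool (t \<in> R X) :: int)"
    have "\<exists>P. lowdeg (C * l ^ d) P \<and>
      card (mod_errors p V (\<lambda>X. sat p n (interp (R X) B) v \<phi>) P) * 2 ^ l \<le> K * n ^ k * 2 ^ card V"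
      by (rule IH[rule_format, OF a(1-3)]) (use a(4) in simp)
    then obtain P where P: "lowdeg (C * l ^ d) P"
      "card (mod_errors p V (\<lambda>X. sat p n (interp (R X) B) v \<phi>) P) * 2 ^ l \<le> K * n ^ k * 2 ^ card V"
      by blast
    have "mod_errors p V (\<lambda>X. sat p n (interp (R X) B) v (Neg \<phi>)) (\<lambda>X. 1 - P X) =
      mod_errors p V (\<lambda>X. sat p n (interp (R X) B) v \<phi>) P"
    proof -
      have "[1 - x = of_bool (\<not> b)] (mod m) \<longleftrightarrow> [x = of_bool b] (mod m)" for x m :: int and b
        using dvd_diff_commute[of m 1 x] by (cases b) (simp_all add: cong_iff_dvd_diff)
      then show ?thesis by (simp add: mod_errors_def)
    qed
    then show "\<exists>P. lowdeg (C * l ^ d) P \<and>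
      card (mod_errors p V (\<lambda>X. sat p n (interp (R X) B) v (Neg \<phi>)) P) * 2 ^ l \<le> K * n ^ k * 2 ^ card V"
      using P by (intro exI[of _ "\<lambda>X. 1 - P X"]) (auto intro: lowdeg_diff lowdeg_const)
  qed
  then show ?case by blast
next
  case (Conj \<phi> \<psi>)
  from Conj.IH(1) obtain C d K k where IH1: "?A \<phi> C d K k" by blast
  from Conj.IH(2) obtain C' d' K' k' where IH2: "?A \<psi> C' d' K' k'" by blast
  have "?A (Conj \<phi> \<psi>) (C + C') (max d d') (K + K') (max k k')"
  proof (intro allI impI)
    fix n l :: nat and V :: "'a set" and R :: "'a set \<Rightarrow> nat list set" and B :: "nat \<Rightarrow> nat list set" and v :: "nat \<Rightarrow> nat"
    assume a: "n \<ge> 1" "l \<ge> 1" "finite V" "\<forall>t. lowdeg 1 (\<lambda>X. of_bool (t \<in> R X) :: int)"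
    have "\<exists>P. lowdeg (C * l ^ d) P \<and>
      card (mod_errors p V (\<lambda>X. sat p n (interp (R X) B) v \<phi>) P) * 2 ^ l \<le> K * n ^ k * 2 ^ card V"
      by (rule IH1[rule_format, OF a(1-3)]) (use a(4) in simp)
    then obtain P where P: "lowdeg (C * l ^ d) P"
      "card (mod_errors p V (\<lambda>X. sat p n (interp (R X) B) v \<phi>) P) * 2 ^ l \<le> K * n ^ k * 2 ^ card V"
      by blast
    have "\<exists>Q. lowdeg (C' * l ^ d') Q \<and>
      card (mod_errors p V (\<lambda>X. sat p n (interp (R X) B) v \<psi>) Q) * 2 ^ l \<le> K' * n ^ k' * 2 ^ card V"
      by (rule IH2[rule_format, OF a(1-3)]) (use a(4) in simp)
    then obtain Q where Q: "lowdeg (C' * l ^ d') Q"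
      "card (mod_errors p V (\<lambda>X. sat p n (interp (R X) B) v \<psi>) Q) * 2 ^ l \<le> K' * n ^ k' * 2 ^ card V"
      by blast
    let ?E = "mod_errors p V (\<lambda>X. sat p n (interp (R X) B) v (Conj \<phi> \<psi>)) (\<lambda>X. P X * Q X)"
    \<comment> \<open>Degrees add up under the product; \<open>l \<ge> 1\<close> allows passing to
      the larger exponent.\<close>
    have "C * l ^ d + C' * l ^ d' \<le> (C + C') * l ^ max d d'"
      using a by (auto simp: distrib_right intro!: add_mono power_increasing)
    then have deg: "lowdeg ((C + C') * l ^ max d d') (\<lambda>X. P X * Q X)"
      using lowdeg.mono[OF lowdeg.mult] P(1) Q(1) by blast
    have "?E \<subseteq> mod_errors p V (\<lambda>X. sat p n (interp (R X) B) v \<phi>) P \<union>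
        mod_errors p V (\<lambda>X. sat p n (interp (R X) B) v \<psi>) Q"
    proof (rule subsetI, rule ccontr)
      fix X assume X: "X \<in> ?E" "X \<notin> mod_errors p V (\<lambda>X. sat p n (interp (R X) B) v \<phi>) P \<union>
        mod_errors p V (\<lambda>X. sat p n (interp (R X) B) v \<psi>) Q"
      then have "[P X = of_bool (sat p n (interp (R X) B) v \<phi>)] (mod int p)"
        "[Q X = of_bool (sat p n (interp (R X) B) v \<psi>)] (mod int p)"
        unfolding mod_errors_def by blast+
      from cong_mult[OF this] have "[P X * Q X = of_bool (sat p n (interp (R X) B) v (Conj \<phi> \<psi>))] (mod int p)"
        by (simp only: sat.simps of_bool_conj)
      then show False using X(1) by (simp only: mod_errors_def mem_Collect_eq) blast
    qed
    then have "card ?E * 2 ^ l \<le> card (mod_errors p V (\<lambda>X. sat p n (interp (R X) B) v \<phi>) P \<union>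
        mod_errors p V (\<lambda>X. sat p n (interp (R X) B) v \<psi>) Q) * 2 ^ l"
      using a by (intro mult_le_mono1 card_mono) (auto simp: finite_mod_errors)
    also have "\<dots> \<le> (card (mod_errors p V (\<lambda>X. sat p n (interp (R X) B) v \<phi>) P) +
        card (mod_errors p V (\<lambda>X. sat p n (interp (R X) B) v \<psi>) Q)) * 2 ^ l"
      by (intro mult_le_mono1 card_Un_le)
    also have "\<dots> \<le> K * n ^ k * 2 ^ card V + K' * n ^ k' * 2 ^ card V"
      using P(2) Q(2) by (simp add: add_mult_distrib)
    also have "\<dots> \<le> K * n ^ max k k' * 2 ^ card V + K' * n ^ max k k' * 2 ^ card V"
      using a by (intro add_mono mult_le_mono1 mult_le_mono2 power_increasing) auto
    finally show "\<exists>P. lowdeg ((C + C') * l ^ max d d') P \<and>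
      card (mod_errors p V (\<lambda>X. sat p n (interp (R X) B) v (Conj \<phi> \<psi>)) P) * 2 ^ l
        \<le> (K + K') * n ^ max k k' * 2 ^ card V"
      using deg by (intro exI[of _ "\<lambda>X. P X * Q X"]) (auto simp: add_mult_distrib)
  qed
  then show ?case by blast
next
  case (Ex x \<phi>)
  then obtain C d K k where IH: "?A \<phi> C d K k" by blast
  \<comment> \<open>The \<open>l\<close> tests cost a factor \<open>l * p\<close> in the degree, and
    the union over \<open>n\<close> instances costs a factor \<open>n\<close> in the error. The
    summand in \<open>K + 1\<close> pays for the inputs that the tests miss.\<close>
  have "?A (Ex x \<phi>) (p * C) (Suc d) (K + 1) (Suc k)"
  proof (intro allI impI)
    fix n l :: nat and V :: "'a set" and R :: "'a set \<Rightarrow> nat list set" and B :: "nat \<Rightarrow> nat list set" and v :: "nat \<Rightarrow> nat"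
    assume a: "n \<ge> 1" "l \<ge> 1" "finite V" "\<forall>t. lowdeg 1 (\<lambda>X. of_bool (t \<in> R X) :: int)"
    have "\<exists>P. lowdeg (C * l ^ d) P \<and>
      card (mod_errors p V (\<lambda>X. sat p n (interp (R X) B) (v(x := i)) \<phi>) P) * 2 ^ l \<le> K * n ^ k * 2 ^ card V" for i
      by (rule IH[rule_format, OF a(1-3)]) (use a(4) in simp)
    then have "\<exists>P. \<forall>i. lowdeg (C * l ^ d) (P i) \<and>
      card (mod_errors p V (\<lambda>X. sat p n (interp (R X) B) (v(x := i)) \<phi>) (P i)) * 2 ^ l \<le> K * n ^ k * 2 ^ card V"
      by (intro choice allI)
    then obtain P where P: "\<And>i. lowdeg (C * l ^ d) (P i)"
      "\<And>i. card (mod_errors p V (\<lambda>X. sat p n (interp (R X) B) (v(x := i)) \<phi>) (P i)) * 2 ^ l \<le> K * n ^ k * 2 ^ card V"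
      by blast
    have "\<exists>Q. lowdeg (l * (p * (C * l ^ d))) Q \<and>
      card (mod_errors p V (\<lambda>X. \<exists>i<n. sat p n (interp (R X) B) (v(x := i)) \<phi>) Q) * 2 ^ l
        \<le> n * (K * n ^ k * 2 ^ card V) + 2 ^ card V"
      by (rule approx_Ex[OF assms a(3)]) (rule P)+
    then obtain Q where Q: "lowdeg (l * (p * (C * l ^ d))) Q"
      "card (mod_errors p V (\<lambda>X. \<exists>i<n. sat p n (interp (R X) B) (v(x := i)) \<phi>) Q) * 2 ^ l
        \<le> n * (K * n ^ k * 2 ^ card V) + 2 ^ card V"
      by blast
    have "n * (K * n ^ k * 2 ^ card V) + 2 ^ card V \<le> (K + 1) * n ^ Suc k * 2 ^ card V"
      using a(1) by (simp add: algebra_simps)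
    then show "\<exists>P. lowdeg (p * C * l ^ Suc d) P \<and>
      card (mod_errors p V (\<lambda>X. sat p n (interp (R X) B) v (Ex x \<phi>)) P) * 2 ^ l
        \<le> (K + 1) * n ^ Suc k * 2 ^ card V"
      using Q by (intro exI[of _ Q]) (auto simp: mult_ac)
  qed
  then show ?case by blast
next
  case (ExMod x \<phi>)
  then obtain C d K k where IH: "?A \<phi> C d K k" by blast
  have "?A (ExMod x \<phi>) (p * C) d K (Suc k)"
  proof (intro allI impI)
    fix n l :: nat and V :: "'a set" and R :: "'a set \<Rightarrow> nat list set" and B :: "nat \<Rightarrow> nat list set" and v :: "nat \<Rightarrow> nat"
    assume a: "n \<ge> 1" "l \<ge> 1" "finite V" "\<forall>t. lowdeg 1 (\<lambda>X. of_bool (t \<in> R X) :: int)"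
    have "\<exists>P. lowdeg (C * l ^ d) P \<and>
      card (mod_errors p V (\<lambda>X. sat p n (interp (R X) B) (v(x := i)) \<phi>) P) * 2 ^ l \<le> K * n ^ k * 2 ^ card V" for i
      by (rule IH[rule_format, OF a(1-3)]) (use a(4) in simp)
    then have "\<exists>P. \<forall>i. lowdeg (C * l ^ d) (P i) \<and>
      card (mod_errors p V (\<lambda>X. sat p n (interp (R X) B) (v(x := i)) \<phi>) (P i)) * 2 ^ l \<le> K * n ^ k * 2 ^ card V"
      by (intro choice allI)
    then obtain P where P: "\<And>i. lowdeg (C * l ^ d) (P i)"
      "\<And>i. card (mod_errors p V (\<lambda>X. sat p n (interp (R X) B) (v(x := i)) \<phi>) (P i)) * 2 ^ l \<le> K * n ^ k * 2 ^ card V"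
      by blast
    have "\<exists>Q. lowdeg (p * (C * l ^ d)) Q \<and>
      card (mod_errors p V (\<lambda>X. p dvd card {i. i < n \<and> sat p n (interp (R X) B) (v(x := i)) \<phi>}) Q) * 2 ^ l
        \<le> n * (K * n ^ k * 2 ^ card V)"
      by (rule approx_ExMod[OF assms a(3)]) (rule P)+
    then obtain Q where Q: "lowdeg (p * (C * l ^ d)) Q"
      "card (mod_errors p V (\<lambda>X. p dvd card {i. i < n \<and> sat p n (interp (R X) B) (v(x := i)) \<phi>}) Q) * 2 ^ l
        \<le> n * (K * n ^ k * 2 ^ card V)"
      by blast
    then show "\<exists>P. lowdeg (p * C * l ^ d) P \<and>
      card (mod_errors p V (\<lambda>X. sat p n (interp (R X) B) v (ExMod x \<phi>)) P) * 2 ^ l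
        \<le> K * n ^ Suc k * 2 ^ card V"
      by (intro exI[of _ Q]) (auto simp: mult_ac)
  qed
  then show ?case by blast
qed

subsection \<open>The Smolensky bound\<close>

text \<open>The map \<open>F\<close> sends ring elements to their classes: its kernel is a ring
  congruence with finitely many, but at least two, classes. This avoids constructing the quotient as
  a type.\<close>

locale finite_quotient =
  fixes F :: "'a::comm_ring_1 \<Rightarrow> 'b"
  assumes cong_add: "F a = F b \<Longrightarrow> F (a + c) = F (b + c)"
    and cong_mult: "F a = F b \<Longrightarrow> F (a * c) = F (b * c)"
    and finite_range: "finite (range F)"
    and nontrivial: "F 0 \<noteq> F 1"
begin

lemma cong_add2: "F a = F b \<Longrightarrow> F c = F d \<Longrightarrow> F (a + c) = F (b + d)"
  by (metis cong_add add.commute)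

lemma cong_mult2: "F a = F b \<Longrightarrow> F c = F d \<Longrightarrow> F (a * c) = F (b * d)"
  by (metis cong_mult mult.commute)

lemma cong_sum: "(\<And>x. x \<in> A \<Longrightarrow> F (f x) = F (g x)) \<Longrightarrow> F (\<Sum>x\<in>A. f x) = F (\<Sum>x\<in>A. g x)"
  by (induction A rule: infinite_finite_induct) (auto intro: cong_add2)

lemma cong_prod: "(\<And>x. x \<in> A \<Longrightarrow> F (f x) = F (g x)) \<Longrightarrow> F (\<Prod>x\<in>A. f x) = F (\<Prod>x\<in>A. g x)"
  by (induction A rule: infinite_finite_induct) (auto intro: cong_mult2)

lemma cong_power: "F a = F b \<Longrightarrow> F (a ^ k) = F (b ^ k)"
  by (induction k) (auto intro: cong_mult2)

text \<open>If every function on \<open>G\<close> with values in the quotient comes from a choice of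
  coefficients for the monomials of degree at most \<open>d\<close>, there are at least as many
  choices of coefficients as functions. Both numbers are powers of \<open>card R > 1\<close>, so the
  exponents compare.\<close>

lemma card_le_of_lowdeg_representation:
  assumes "finite V" "G \<subseteq> Pow V"
    and rep: "\<And>h. \<exists>g. lowdeg d g \<and> (\<forall>X\<in>G. F (g X) = F (h X))"
  shows "card G \<le> card {T. T \<subseteq> V \<and> card T \<le> d}"
proof -
  define M where "M = {T. T \<subseteq> V \<and> card T \<le> d}"
  define R where "R = range F"
  \<comment> \<open>A choice of representatives, which lifts functions into the quotient to
    functions into the ring.\<close>
  define r where "r = inv_into UNIV F"
  define ev where "ev = (\<lambda>c. \<lambda>X\<in>G. F (\<Sum>T\<in>M. r (c T) * of_bool (T \<subseteq> X)))"
  have r: "F (r y) = y" if "y \<in> R" for y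
    using that by (simp add: R_def r_def f_inv_into_f)
  have fin: "finite M" "finite G" "finite R"
    using assms(1,2) finite_range by (auto simp: M_def R_def intro: finite_subset)
  have "(G \<rightarrow>\<^sub>E R) \<subseteq> ev ` (M \<rightarrow>\<^sub>E R)"
  proof
    fix h assume h: "h \<in> G \<rightarrow>\<^sub>E R"
    obtain g where g: "lowdeg d g" "\<forall>X\<in>G. F (g X) = F (r (h X))"
      using rep[of "\<lambda>X. r (h X)"] by blast
    obtain c where c: "\<forall>X\<subseteq>V. g X = (\<Sum>T\<in>M. c T * of_bool (T \<subseteq> X))"
      using lowdeg_imp_monomials[OF g(1) assms(1)] unfolding M_def by blast
    define c' where "c' = (\<lambda>T\<in>M. F (c T))"
    have "ev c' = h"
    proof
      fix X
      show "ev c' X = h X"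
      proof (cases "X \<in> G")
        case True
        have "ev c' X = F (\<Sum>T\<in>M. c T * of_bool (T \<subseteq> X))"
          using True unfolding ev_def
          by (auto simp: c'_def R_def r simp del: sum_mult_of_bool_eq intro!: cong_sum cong_mult)
        also have "\<dots> = F (g X)" using True assms(2) c by (auto simp del: sum_mult_of_bool_eq)
        also have "\<dots> = h X" using True g(2) h r by auto
        finally show ?thesis .
      next
        case False
        then show ?thesis using h by (auto simp: ev_def)
      qed
    qed
    moreover have "c' \<in> M \<rightarrow>\<^sub>E R" by (simp add: c'_def R_def)
    ultimately show "h \<in> ev ` (M \<rightarrow>\<^sub>E R)" by blast
  qed
  then have "card (G \<rightarrow>\<^sub>E R) \<le> card (M \<rightarrow>\<^sub>E R)"
    using fin by (intro surj_card_le finite_PiE) auto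
  then have "card R ^ card G \<le> card R ^ card M"
    using fin by (simp add: card_funcsetE)
  moreover have "card R > 1"
  proof -
    have "card {F 0, F 1} \<le> card R" using fin by (intro card_mono) (auto simp: R_def)
    then show ?thesis using nontrivial by simp
  qed
  ultimately show ?thesis unfolding M_def[symmetric] by (rule power_le_imp_le_exp[rotated])
qed

end

text \<open>
  Equations \<open>F a = F b\<close> stand for equality in the quotient ring. There \<open>u\<close> inverts \<open>w - 1\<close>, so
  that \<open>w ^ [i \<in> X]\<close> and \<open>[i \<in> X]\<close> are affine functions of each other. No field is needed.
\<close>

locale root_of_unity_quotient = finite_quotient F for F :: "'a::comm_ring_1 \<Rightarrow> 'b" +
  fixes p q :: nat and w u :: 'a
  assumes char_p: "F (of_nat p) = F 0"
    and root: "F (w ^ q) = F 1"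
    and inv: "F (u * (w - 1)) = F 1"
    and q_pos: "q > 0"
begin

lemma cong_of_int:
  assumes "[x = y] (mod int p)"
  shows "F (of_int x) = F (of_int y)"
proof -
  obtain k where "x = y + int p * k"
    using cong_sym[OF assms] unfolding cong_iff_lin by blast
  then have "F (of_int x) = F (of_int y + of_nat p * of_int k)" by simp
  also have "\<dots> = F (of_int y + 0 * of_int k)"
    by (intro cong_add2 cong_mult char_p) simp
  finally show ?thesis by simp
qed

lemma cong_power_mod: "F (w ^ (q * k)) = F 1"
  using cong_power[OF root, of k] by (simp add: power_mult)

lemma cong_power_eq:
  assumes "[i = j] (mod q)"
  shows "F (w ^ i) = F (w ^ j)"
proof -
  have *: "F (w ^ i) = F (w ^ (i mod q))" for i
  proof -
    have "F (w ^ (q * (i div q)) * w ^ (i mod q)) = F (1 * w ^ (i mod q))"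
      by (intro cong_mult cong_power_mod)
    then show ?thesis by (simp flip: power_add)
  qed
  show ?thesis using *[of i] *[of j] assms by (simp add: Cong.cong_def)
qed

text \<open>Exactly one \<open>i < q\<close> satisfies \<open>q dvd card X + i\<close>, and for it
  \<open>w ^ (q - i)\<close> equals \<open>w ^ card X\<close> in the quotient. Weighting the
  \<open>q\<close> divisibility tests accordingly leaves just this power.\<close>

lemma root_power_lowdeg:
  assumes P: "\<And>i. i < q \<Longrightarrow> lowdeg D (P i)"
    and G: "\<And>i X. i < q \<Longrightarrow> X \<in> G \<Longrightarrow> [P i X = of_bool (q dvd card X + i)] (mod int p)"
  shows "\<exists>W. lowdeg D W \<and> (\<forall>X\<in>G. F (W X) = F (w ^ card X))"
proof (intro exI conjI ballI)
  let ?W = "\<lambda>X. \<Sum>i<q. w ^ (q - i) * of_int (P i X)"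
  show "lowdeg D ?W"
    by (intro lowdeg_sum lowdeg_scale lowdeg_of_int P) simp
  fix X assume X: "X \<in> G"
  \<comment> \<open>The outer \<open>mod q\<close> sends the case of \<open>card X\<close> divisible
    by \<open>q\<close> to \<open>j = 0\<close>; the corresponding weight \<open>w ^ q\<close> is 1
    in the quotient.\<close>
  define j where "j = (q - card X mod q) mod q"
  have j: "j < q" using q_pos by (simp add: j_def)
  have dvd: "q dvd card X + i \<longleftrightarrow> i = j" if "i < q" for i
  proof -
    have "q dvd card X + i \<longleftrightarrow> q dvd card X mod q + i"
      by (simp add: dvd_eq_mod_eq_0 mod_add_left_eq)
    also have "\<dots> \<longleftrightarrow> i = j"
    proof (cases "card X mod q = 0")
      case True
      then show ?thesis using that by (auto simp: j_def dest: dvd_imp_le)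
    next
      case False
      have lt: "card X mod q < q" using q_pos by simp
      then have j': "j = q - card X mod q" using False by (simp add: j_def)
      show ?thesis
      proof
        assume "q dvd card X mod q + i"
        then obtain k where k: "card X mod q + i = q * k" by blast
        have "0 < k" using k False by (cases k) auto
        moreover have "k < 2"
        proof -
          have "q * k < q * 2" using k lt that by linarith
          then show ?thesis by simp
        qed
        ultimately have "k = 1" by simp
        then show "i = j" using k j' by simp
      qed (use j' lt in simp)
    qed
    finally show ?thesis .
  qed
  have "F (?W X) = F (\<Sum>i<q. w ^ (q - i) * of_int (of_bool (q dvd card X + i)))"
    using G X by (intro cong_sum cong_mult2 refl cong_of_int) auto
  also have "(\<Sum>i<q. w ^ (q - i) * of_int (of_bool (q dvd card X + i))) =
      (\<Sum>i<q. if i = j then w ^ (q - j) else 0)"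
    using dvd by (intro sum.cong) auto
  also have "\<dots> = w ^ (q - j)" using j by simp
  also have "F \<dots> = F (w ^ card X)"
  proof (rule cong_power_eq)
    have "[(q - j) + j = card X + j] (mod q)"
      using dvd[OF j] j by (simp add: Cong.cong_def)
    then show "[q - j = card X] (mod q)" by (simp add: cong_add_rcancel_nat)
  qed
  finally show "F (?W X) = F (w ^ card X)" .
qed

lemma prod_of_bool: "finite V \<Longrightarrow> (\<Prod>i\<in>V. of_bool (P i)) = (of_bool (\<forall>i\<in>V. P i) :: 'a)"
  by (induction V rule: finite_induct) auto

lemma indicator_prod:
  assumes "finite V" "X \<subseteq> V" "S \<subseteq> V"
  shows "of_bool (X = S) = (\<Prod>i\<in>V. if i \<in> S then of_bool (i \<in> X) else 1 - of_bool (i \<in> X) :: 'a)"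
proof -
  have "(X = S) = (\<forall>i\<in>V. (i \<in> X) = (i \<in> S))" using assms by blast
  then have "of_bool (X = S) = (\<Prod>i\<in>V. of_bool ((i \<in> X) = (i \<in> S)) :: 'a)"
    using prod_of_bool[OF assms(1)] by simp
  also have "\<dots> = (\<Prod>i\<in>V. if i \<in> S then of_bool (i \<in> X) else 1 - of_bool (i \<in> X))"
    by (intro prod.cong) auto
  finally show ?thesis .
qed

text \<open>A Fourier-like expansion: the indicator of a set \<open>S\<close> is a product over
  \<open>i \<in> V\<close> of factors affine in \<open>w ^ [i \<in> X]\<close>, and multiplying out
  yields the functions \<open>w ^ card (T \<inter> X)\<close>. Indicators combine to any function
  \<open>h\<close>.\<close>

lemma span_root_powers:
  assumes "finite V"
  shows "\<exists>c. \<forall>X\<subseteq>V. F (h X) = F (\<Sum>T\<in>Pow V. c T * w ^ card (T \<inter> X))"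
proof -
  define N where "N = (\<lambda>h. \<exists>c. \<forall>X\<subseteq>V. F (h X) = F (\<Sum>T\<in>Pow V. c T * w ^ card (T \<inter> X)))"
  have sm: "N (\<lambda>X. \<Sum>S\<in>A. h S * g S X)" if "\<And>S. S \<in> A \<Longrightarrow> N (g S)" for A :: "'c set set" and h g
  proof -
    have "\<forall>S\<in>A. \<exists>c. \<forall>X\<subseteq>V. F (g S X) = F (\<Sum>T\<in>Pow V. c T * w ^ card (T \<inter> X))"
      using that unfolding N_def by blast
    from bchoice[OF this] obtain c where c: "\<forall>S\<in>A. \<forall>X\<subseteq>V. F (g S X) = F (\<Sum>T\<in>Pow V. c S T * w ^ card (T \<inter> X))"
      by blast
    show ?thesis unfolding N_def
    proof (intro exI allI impI)
      fix X assume "X \<subseteq> V"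
      then have "F (\<Sum>S\<in>A. h S * g S X) = F (\<Sum>S\<in>A. h S * (\<Sum>T\<in>Pow V. c S T * w ^ card (T \<inter> X)))"
        using c by (intro cong_sum cong_mult2 refl) auto
      also have "(\<Sum>S\<in>A. h S * (\<Sum>T\<in>Pow V. c S T * w ^ card (T \<inter> X))) =
          (\<Sum>T\<in>Pow V. (\<Sum>S\<in>A. h S * c S T) * w ^ card (T \<inter> X))"
        by (simp add: sum_distrib_left sum_distrib_right mult.assoc) (rule sum.swap)
      finally show "F (\<Sum>S\<in>A. h S * g S X) = F (\<Sum>T\<in>Pow V. (\<Sum>S\<in>A. h S * c S T) * w ^ card (T \<inter> X))" .
    qed
  qed
  have pw: "w ^ card (T \<inter> X) = (\<Prod>i\<in>T. if i \<in> X then w else 1)" if "T \<subseteq> V" for T X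
    using finite_subset[OF that assms] by (simp add: prod.If_cases Int_def)
  have ind: "N (\<lambda>X. of_bool (X = S))" if "S \<subseteq> V" for S
  proof -
    \<comment> \<open>With \<open>y\<close> equal to \<open>w\<close> if \<open>i \<in> X\<close>
      and to 1 otherwise, \<open>\<alpha> i * y + \<beta> i\<close> equals
      \<open>u * (y - 1)\<close> for \<open>i \<in> S\<close> and \<open>1 - u * (y - 1)\<close> for
      other \<open>i\<close>. As \<open>u * (w - 1)\<close> is 1 in the quotient, these are the bit
      of \<open>i\<close> and its negation.\<close>
    define \<alpha> \<beta> where "\<alpha> = (\<lambda>i. if i \<in> S then u else - u)" and "\<beta> = (\<lambda>i. if i \<in> S then - u else 1 + u)"
    have "F (of_bool (X = S)) = F (\<Sum>T\<in>Pow V. ((\<Prod>i\<in>T. \<alpha> i) * (\<Prod>i\<in>V - T. \<beta> i)) * w ^ card (T \<inter> X))"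
      if "X \<subseteq> V" for X
    proof -
      have *: "F (1 - u * (w - 1)) = F 0"
        using cong_add[OF inv[symmetric], of "- (u * (w - 1))"] by simp
      have "F (of_bool (X = S)) = F (\<Prod>i\<in>V. if i \<in> S then of_bool (i \<in> X) else 1 - of_bool (i \<in> X))"
        using indicator_prod[OF assms that \<open>S \<subseteq> V\<close>] by simp
      also have "\<dots> = F (\<Prod>i\<in>V. \<alpha> i * (if i \<in> X then w else 1) + \<beta> i)"
      proof (rule cong_prod)
        fix i
        show "F (if i \<in> S then of_bool (i \<in> X) else 1 - of_bool (i \<in> X)) =
          F (\<alpha> i * (if i \<in> X then w else 1) + \<beta> i)"
          using inv * by (simp add: \<alpha>_def \<beta>_def algebra_simps)
      qed
      also have "(\<Prod>i\<in>V. \<alpha> i * (if i \<in> X then w else 1) + \<beta> i) =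
          (\<Sum>T\<in>Pow V. (\<Prod>i\<in>T. \<alpha> i * (if i \<in> X then w else 1)) * (\<Prod>i\<in>V - T. \<beta> i))"
        by (rule prod_add[OF assms])
      also have "\<dots> = (\<Sum>T\<in>Pow V. ((\<Prod>i\<in>T. \<alpha> i) * (\<Prod>i\<in>V - T. \<beta> i)) * w ^ card (T \<inter> X))"
        by (intro sum.cong) (auto simp: prod.distrib pw mult_ac)
      finally show ?thesis .
    qed
    then show ?thesis unfolding N_def by (intro exI allI impI)
  qed
  obtain c where c: "\<And>X. X \<subseteq> V \<Longrightarrow> F (\<Sum>S\<in>Pow V. h S * of_bool (X = S)) = F (\<Sum>T\<in>Pow V. c T * w ^ card (T \<inter> X))"
    using sm[of "Pow V" "\<lambda>S X. of_bool (X = S)" h] ind unfolding N_def by auto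
  have "(\<Sum>S\<in>Pow V. h S * of_bool (X = S)) = h X" if "X \<subseteq> V" for X
    using that assms by (subst sum.remove[of _ X]) auto
  then show ?thesis using c by metis
qed

text \<open>For large \<open>T\<close> the complement is used:
  \<open>w ^ card (T \<inter> X)\<close> is \<open>w ^ card X\<close> times the inverse of
  \<open>w ^ card ((V - T) \<inter> X)\<close>, where \<open>w ^ (q - 1)\<close> serves as the
  inverse of \<open>w\<close>. The first factor has degree \<open>D\<close> on \<open>G\<close>, the
  second at most \<open>h\<close>.\<close>

lemma high_degree_conversion:
  assumes "finite V" "T \<subseteq> V" "lowdeg D W" "\<And>X. X \<in> G \<Longrightarrow> F (W X) = F (w ^ card X)" "G \<subseteq> Pow V"
    and "card V \<le> 2 * h"
  shows "\<exists>g. lowdeg (h + D) g \<and> (\<forall>X\<in>G. F (g X) = F (w ^ card (T \<inter> X)))"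
proof (cases "card T \<le> h")
  case True
  have finT: "finite T" using assms finite_subset by blast
  have "lowdeg (card T * 1) (\<lambda>X. \<Prod>i\<in>T. if i \<in> X then w else 1)"
    by (intro lowdeg_prod lowdeg_if)
  then have "lowdeg (h + D) (\<lambda>X. \<Prod>i\<in>T. if i \<in> X then w else 1)"
    by (rule lowdeg.mono) (use True in simp)
  moreover have "(\<Prod>i\<in>T. if i \<in> X then w else 1) = w ^ card (T \<inter> X)" for X
    using finT by (simp add: prod.If_cases Int_def)
  ultimately show ?thesis by force
next
  case False
  have finT: "finite T" "finite (V - T)" using assms finite_subset by blast+
  define g where "g = (\<lambda>X. (\<Prod>i\<in>V - T. if i \<in> X then w ^ (q - 1) else 1) * W X)"
  have "card (V - T) \<le> h" using False assms finT by (subst card_Diff_subset) auto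
  moreover have "lowdeg (card (V - T) * 1 + D) g" unfolding g_def
    by (intro lowdeg.mult lowdeg_prod lowdeg_if assms)
  ultimately have "lowdeg (h + D) g" using lowdeg.mono by fastforce
  moreover have "F (g X) = F (w ^ card (T \<inter> X))" if X: "X \<in> G" for X
  proof -
    have fX: "finite X" using X assms(1,5) by (auto intro: finite_subset)
    have "card X = card (T \<inter> X) + card ((V - T) \<inter> X)"
      using fX X assms(5) by (subst card_Un_disjoint[symmetric]) (auto intro!: arg_cong[of _ _ card])
    then have eq: "(q - 1) * card ((V - T) \<inter> X) + card X = q * card ((V - T) \<inter> X) + card (T \<inter> X)"
      using q_pos by (cases q) auto
    have "F (g X) = F ((w ^ (q - 1)) ^ card ((V - T) \<inter> X) * w ^ card X)"
      unfolding g_def using finT X assms(4)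
      by (intro cong_mult2) (simp_all add: prod.If_cases Int_def)
    also have "\<dots> = F (w ^ (q * card ((V - T) \<inter> X) + card (T \<inter> X)))"
      by (simp flip: power_mult power_add eq)
    also have "\<dots> = F (w ^ card (T \<inter> X))"
      by (rule cong_power_eq) (simp add: Cong.cong_def)
    finally show ?thesis .
  qed
  ultimately show ?thesis by blast
qed

text \<open>On \<open>G\<close> each function spanning all functions has degree at most
  \<open>h + D\<close>, so every function has, and counting bounds the size of
  \<open>G\<close>.\<close>

lemma smolensky_bound:
  assumes "finite V" "card V \<le> 2 * h" "G \<subseteq> Pow V"
    and P: "\<And>i. i < q \<Longrightarrow> lowdeg D (P i)"
    and G: "\<And>i X. i < q \<Longrightarrow> X \<in> G \<Longrightarrow> [P i X = of_bool (q dvd card X + i)] (mod int p)"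
  shows "card G \<le> card {T. T \<subseteq> V \<and> card T \<le> h + D}"
proof (rule card_le_of_lowdeg_representation[OF assms(1,3)])
  fix f :: "'c set \<Rightarrow> 'a"
  have "\<exists>W. lowdeg D W \<and> (\<forall>X\<in>G. F (W X) = F (w ^ card X))"
    by (rule root_power_lowdeg[OF P G])
  then obtain W where W: "lowdeg D W" "\<And>X. X \<in> G \<Longrightarrow> F (W X) = F (w ^ card X)"
    by blast
  have "\<exists>g. lowdeg (h + D) g \<and> (\<forall>X\<in>G. F (g X) = F (w ^ card (T \<inter> X)))" if "T \<in> Pow V" for T
    using high_degree_conversion[OF assms(1) _ W assms(3,2)] that by blast
  then obtain g where g: "\<And>T. T \<in> Pow V \<Longrightarrow> lowdeg (h + D) (g T)"
    "\<And>T X. T \<in> Pow V \<Longrightarrow> X \<in> G \<Longrightarrow> F (g T X) = F (w ^ card (T \<inter> X))"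
    by metis
  obtain c where c: "\<forall>X\<subseteq>V. F (f X) = F (\<Sum>T\<in>Pow V. c T * w ^ card (T \<inter> X))"
    using span_root_powers[OF assms(1)] by blast
  show "\<exists>g. lowdeg (h + D) g \<and> (\<forall>X\<in>G. F (g X) = F (f X))"
  proof (intro exI conjI ballI)
    show "lowdeg (h + D) (\<lambda>X. \<Sum>T\<in>Pow V. c T * g T X)"
      by (intro lowdeg_sum lowdeg_scale g)
    fix X assume X: "X \<in> G"
    have "F (\<Sum>T\<in>Pow V. c T * g T X) = F (\<Sum>T\<in>Pow V. c T * w ^ card (T \<inter> X))"
      using X by (intro cong_sum cong_mult2 refl g)
    then show "F (\<Sum>T\<in>Pow V. c T * g T X) = F (f X)" using c X assms(3) by auto
  qed
qed

end

subsection \<open>Roots of unity and binomial estimates\<close>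

text \<open>The action of the polynomial ring on integer sequences in which the variable is the
  shift operator, evaluated at position \<open>j\<close>.\<close>

definition shift_action :: "int poly \<Rightarrow> (nat \<Rightarrow> int) \<Rightarrow> nat \<Rightarrow> int" where
  "shift_action a s j = (\<Sum>i\<le>degree a. coeff a i * s (i + j))"

lemma shift_action_bound:
  "degree a \<le> N \<Longrightarrow> shift_action a s j = (\<Sum>i\<le>N. coeff a i * s (i + j))"
  unfolding shift_action_def by (intro sum.mono_neutral_left) (auto simp: coeff_eq_0)

lemma shift_action_0 [simp]: "shift_action 0 s j = 0"
  by (simp add: shift_action_def)

lemma shift_action_add: "shift_action (a + b) s j = shift_action a s j + shift_action b s j"
proof -
  define N where "N = max (degree a) (degree b)"
  have "degree a \<le> N" "degree b \<le> N" "degree (a + b) \<le> N"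
    by (auto simp: N_def intro: degree_add_le)
  then show ?thesis by (simp add: shift_action_bound sum.distrib distrib_right)
qed

lemma shift_action_pCons:
  "shift_action (pCons c a) s j = c * s j + shift_action a s (Suc j)"
proof -
  have "shift_action (pCons c a) s j = (\<Sum>i\<le>Suc (degree a). coeff (pCons c a) i * s (i + j))"
    by (intro shift_action_bound degree_pCons_le)
  also have "\<dots> = c * s j + (\<Sum>i\<le>degree a. coeff a i * s (i + Suc j))"
    by (subst sum.atMost_Suc_shift) simp
  finally show ?thesis by (simp add: shift_action_def)
qed

lemma shift_action_smult: "shift_action (smult c a) s j = c * shift_action a s j"
  by (induction a arbitrary: j) (auto simp: shift_action_pCons algebra_simps)

lemma shift_action_sum: "shift_action (\<Sum>i\<in>A. f i) s j = (\<Sum>i\<in>A. shift_action (f i) s j)"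
  by (induction A rule: infinite_finite_induct) (auto simp: shift_action_add)

lemma shift_action_X_power: "shift_action ([:0, 1:] ^ k) s j = s (k + j)"
proof (induction k arbitrary: j)
  case 0
  show ?case by (simp add: one_pCons shift_action_pCons)
next
  case (Suc k)
  have "[:0, 1:] ^ Suc k = pCons 0 ([:0, 1:] ^ k :: int poly)" by simp
  then show ?case by (simp only: shift_action_pCons Suc.IH) simp
qed

text \<open>
  Letting polynomials act by shifts on the sequence \<open>(x - 1) [q dvd j]\<close> modulo \<open>p\<close> yields the
  quotient of \<open>\<int>[x]\<close> by the ideal generated by \<open>p\<close> and \<open>1 + x + \<dots> + x ^ (q - 1)\<close>.
\<close>

lemma ex_root_of_unity_quotient:
  assumes "prime p" "prime q" "p \<noteq> q"
  shows "\<exists>(F :: int poly \<Rightarrow> nat \<Rightarrow> int) w u. root_of_unity_quotient F p q w u"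
proof -
  define s :: "nat \<Rightarrow> int" where "s = (\<lambda>j. of_bool (q dvd j + 1) - of_bool (q dvd j))"
  define F where "F = (\<lambda>a j. shift_action a s j mod int p)"
  have p1: "p > 1" and q1: "q > 1" using assms prime_gt_1_nat by auto
  have F_eq: "F a = F b \<longleftrightarrow> (\<forall>j. [shift_action a s j = shift_action b s j] (mod int p))" for a b
    by (simp add: F_def Cong.cong_def fun_eq_iff)
  interpret finite_quotient F
  proof
    show "F (a + c) = F (b + c)" if "F a = F b" for a b c
      using that unfolding F_eq shift_action_add by (blast intro: Cong.cong_add cong_refl)
    \<comment> \<open>Multiplication by the variable only moves the position from \<open>j\<close>
      to \<open>Suc j\<close>, so a congruence at all positions survives it.\<close>
    show "F (a * c) = F (b * c)" if "F a = F b" for a b c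
    proof (induction c)
      case 0
      show ?case by simp
    next
      case (pCons k c)
      show ?case unfolding F_eq mult_pCons_right shift_action_add shift_action_smult shift_action_pCons
      proof
        fix j
        have "[shift_action a s j = shift_action b s j] (mod int p)"
          "[shift_action (a * c) s (Suc j) = shift_action (b * c) s (Suc j)] (mod int p)"
          using that pCons.IH unfolding F_eq by blast+
        then show "[k * shift_action a s j + (0 * s j + shift_action (a * c) s (Suc j)) =
          k * shift_action b s j + (0 * s j + shift_action (b * c) s (Suc j))] (mod int p)"
          by (intro Cong.cong_add Cong.cong_mult cong_refl)
      qed
    qed
    show "finite (range F)"
    proof (rule finite_subset)
      \<comment> \<open>The sequence \<open>s\<close> has period \<open>q\<close>, so
        \<open>F a\<close> is determined by \<open>q\<close> residues modulo
        \<open>p\<close>.\<close>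
      show "range F \<subseteq> (\<lambda>g j. g (j mod q)) ` ({..<q} \<rightarrow>\<^sub>E {0..<int p})"
      proof (rule image_subsetI)
        fix a
        have "s (i + j) = s (i + j mod q)" for i j
          using mod_add_right_eq[of "i + 1" j q] mod_add_right_eq[of i j q]
          by (simp add: s_def dvd_eq_mod_eq_0)
        then have "F a j = F a (j mod q)" for j by (simp add: F_def shift_action_def)
        then have "F a = (\<lambda>j. (\<lambda>i\<in>{..<q}. F a i) (j mod q))" using q1 by auto
        moreover have "(\<lambda>i\<in>{..<q}. F a i) \<in> {..<q} \<rightarrow>\<^sub>E {0..<int p}"
          using p1 by (auto simp: F_def)
        ultimately show "F a \<in> (\<lambda>g j. g (j mod q)) ` ({..<q} \<rightarrow>\<^sub>E {0..<int p})" by blast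
      qed
    qed (intro finite_imageI finite_PiE, auto)
    have "shift_action 1 s 0 = -1"
      using q1 by (simp add: one_pCons shift_action_pCons s_def)
    then show "F 0 \<noteq> F 1" using p1 by (auto simp: F_eq cong_iff_dvd_diff intro!: exI[of _ 0])
  qed
  have char: "F (of_nat p) = F 0"
    by (simp add: F_eq of_nat_poly shift_action_pCons cong_0_iff)
  let ?w = "[:0, 1:] :: int poly"
  have "s (q + j) = s j" for j
    using dvd_add_right_iff[of q q "Suc j"] by (simp add: s_def)
  then have root: "F (?w ^ q) = F 1"
    unfolding F_eq shift_action_X_power using shift_action_X_power[of 0] by simp
  \<comment> \<open>Here \<open>\<Phi>\<close> annihilates \<open>s\<close> by telescoping. Since
    \<open>\<Phi> - q\<close> is \<open>h\<close> times \<open>?w - 1\<close>, the element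
    \<open>h * (?w - 1)\<close> equals \<open>- q\<close> in the quotient; with \<open>r\<close>
    inverse to \<open>q\<close> modulo \<open>p\<close>, \<open>- r * h\<close> inverts
    \<open>?w - 1\<close>.\<close>
  define \<Phi> where "\<Phi> = (\<Sum>i<q. ?w ^ i)"
  define h where "h = (\<Sum>i<q. \<Sum>j<i. ?w ^ j)"
  have "shift_action \<Phi> s j = 0" for j
  proof -
    have "shift_action \<Phi> s j = (\<Sum>i<q. of_bool (q dvd Suc i + j) - of_bool (q dvd i + j))"
      by (simp add: \<Phi>_def shift_action_sum shift_action_X_power s_def)
    also have "\<dots> = of_bool (q dvd q + j) - of_bool (q dvd 0 + j)"
      by (rule sum_lessThan_telescope)
    finally show ?thesis by simp
  qed
  then have \<Phi>: "F \<Phi> = F 0" by (simp add: F_eq)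
  have "\<Phi> - of_nat q = (\<Sum>i<q. ?w ^ i - 1)"
    by (simp add: \<Phi>_def sum_subtractf)
  also have "\<dots> = h * (?w - 1)"
    by (simp add: h_def sum_distrib_left power_diff_1_eq mult.commute)
  finally have h: "h * (?w - 1) = \<Phi> - of_nat q" by simp
  have "coprime q p" using assms primes_coprime by blast
  then obtain r where "[int q * r = 1] (mod int p)"
    using cong_solve_coprime_int[of "int q" "int p"] by auto
  from cong_sym[OF this] obtain k where r: "int q * r = 1 + int p * k"
    unfolding cong_iff_lin by blast
  have "F ((- of_int r * h) * (?w - 1)) = F (of_nat q * of_int r - \<Phi> * of_int r)"
    unfolding mult.assoc h by (simp add: algebra_simps)
  also have "of_nat q * of_int r = (of_int (int q * r) :: int poly)" by simp
  also have "F (of_int (int q * r) - \<Phi> * of_int r) = F (1 + (of_nat p * of_int k + \<Phi> * of_int (- r)))"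
    unfolding r by (simp add: algebra_simps)
  also have "\<dots> = F (1 + (0 * of_int k + 0 * of_int (- r)))"
    by (intro cong_add2 cong_mult2 refl char \<Phi>)
  finally have "F ((- of_int r * h) * (?w - 1)) = F 1" by simp
  then have "root_of_unity_quotient F p q ?w (- of_int r * h)"
    using char root q1 by unfold_locales auto
  then show ?thesis by blast
qed

section \<open>Few subsets of size up to slightly above half\<close>

text \<open>The estimate \<open>4 ^ h / sqrt (2 * h + 1)\<close> for the central binomial
  coefficient, squared to stay in the naturals. By the recurrence \<open>rec\<close>, the induction
  step comes down to \<open>(2 * h + 1) * (2 * h + 3) \<le> 4 * (Suc h)\<^sup>2\<close>.\<close>

lemma central_binomial_square_le: "((2 * h) choose h)\<^sup>2 * (2 * h + 1) \<le> 16 ^ h"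
proof (induction h)
  case 0
  show ?case by simp
next
  case (Suc h)
  define C where "C = (2 * h) choose h"
  define C' where "C' = (2 * Suc h) choose Suc h"
  have "Suc h * (Suc (2 * h) choose Suc h) = Suc (2 * h) * C"
    unfolding C_def by (rule Suc_times_binomial)
  moreover have "Suc (2 * h) choose Suc h = Suc (2 * h) choose h"
    using binomial_symmetric[of "Suc h" "Suc (2 * h)"] by simp
  moreover have "Suc h * C' = Suc (Suc (2 * h)) * (Suc (2 * h) choose h)"
    unfolding C'_def using Suc_times_binomial[of h "Suc (2 * h)"] by simp
  ultimately have "Suc h * (Suc h * C') = Suc (Suc (2 * h)) * (Suc (2 * h) * C)"
    by (metis mult.left_commute)
  then have "Suc h * (Suc h * C') = Suc h * (2 * (Suc (2 * h) * C))" by simp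
  then have rec: "Suc h * C' = 2 * (Suc (2 * h) * C)" by (simp only: mult_cancel1) simp
  have "(Suc h)\<^sup>2 * (C'\<^sup>2 * (2 * Suc h + 1)) = (Suc h * C')\<^sup>2 * (2 * h + 3)"
    by (simp add: power2_eq_square algebra_simps)
  also have "\<dots> = C\<^sup>2 * (2 * h + 1) * (4 * ((2 * h + 1) * (2 * h + 3)))"
    unfolding rec by (simp add: power2_eq_square algebra_simps)
  also have "\<dots> \<le> 16 ^ h * (4 * ((2 * h + 1) * (2 * h + 3)))"
    using Suc.IH by (intro mult_le_mono1) (simp add: C_def)
  also have "\<dots> \<le> 16 ^ h * (16 * (Suc h)\<^sup>2)"
    by (intro mult_le_mono2) (simp add: power2_eq_square algebra_simps)
  finally have "(Suc h)\<^sup>2 * (C'\<^sup>2 * (2 * Suc h + 1)) \<le> (Suc h)\<^sup>2 * 16 ^ Suc h" by (simp add: mult_ac)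
  then show ?case unfolding C'_def by (simp only: mult_le_cancel1) simp
qed

text \<open>Sets smaller than \<open>h\<close> are at most half of all subsets, as their complements
  are larger than \<open>h\<close>. The \<open>D + 1\<close> layers from \<open>h\<close> on have at
  most \<open>C\<close> sets each, together less than a quarter when \<open>h\<close> is large
  against \<open>D\<^sup>2\<close>.\<close>

lemma card_small_subsets_less:
  assumes "finite V" "card V = 2 * h" "16 * (D + 1)\<^sup>2 \<le> 2 * h"
  shows "4 * card {T. T \<subseteq> V \<and> card T \<le> h + D} < 3 * 4 ^ h"
proof -
  define A where "A = {T. T \<subseteq> V \<and> card T < h}"
  define M where "M = (\<Union>j\<in>{h..h + D}. {T. T \<subseteq> V \<and> card T = j})"
  define C where "C = (2 * h) choose h"
  have finA: "finite A" "finite M" using assms(1) by (auto simp: A_def M_def)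
  have cc: "card (V - T) = 2 * h - card T" if "T \<subseteq> V" for T
    using that assms(1,2) finite_subset[OF that] by (simp add: card_Diff_subset)
  have "2 * card A = card A + card ((-) V ` A)"
    by (subst card_image) (auto simp: A_def inj_on_def)
  also have "\<dots> = card (A \<union> (-) V ` A)"
    using finA by (intro card_Un_disjoint[symmetric]) (auto simp: A_def cc)
  also have "\<dots> \<le> card (Pow V)"
    using assms(1) by (intro card_mono) (auto simp: A_def)
  finally have A: "2 * card A \<le> 4 ^ h"
    using assms(1,2) by (simp add: card_Pow power_mult)
  have "card M \<le> (\<Sum>j\<in>{h..h + D}. card {T. T \<subseteq> V \<and> card T = j})"
    unfolding M_def by (intro card_UN_le) simp
  also have "\<dots> \<le> (\<Sum>j\<in>{h..h + D}. C)"
    using assms(1,2) binomial_maximum'[of h] by (intro sum_mono) (simp add: n_subsets C_def)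
  finally have M: "card M \<le> (D + 1) * C" by simp
  have "4 * ((D + 1) * C) < 4 ^ h"
  proof (rule power2_less_imp_less)
    have "(4 * ((D + 1) * C))\<^sup>2 = (16 * (D + 1)\<^sup>2) * C\<^sup>2"
      by (simp only: power_mult_distrib) simp
    also have "\<dots> \<le> 2 * h * C\<^sup>2" using assms(3) by (rule mult_le_mono1)
    also have "\<dots> < C\<^sup>2 * (2 * h + 1)" by (simp add: C_def)
    also have "\<dots> \<le> 16 ^ h" unfolding C_def by (rule central_binomial_square_le)
    also have "\<dots> = (4 ^ h)\<^sup>2" by (simp flip: power_mult_distrib add: power2_eq_square)
    finally show "(4 * ((D + 1) * C))\<^sup>2 < (4 ^ h)\<^sup>2" .
  qed simp
  moreover have "card {T. T \<subseteq> V \<and> card T \<le> h + D} \<le> card A + card M"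
  proof -
    have "{T. T \<subseteq> V \<and> card T \<le> h + D} = A \<union> M" by (auto simp: A_def M_def)
    then show ?thesis by (simp add: card_Un_le)
  qed
  ultimately show ?thesis using A M by linarith
qed

subsection \<open>Lower bounds for formulas\<close>

text \<open>
  One formula is used for all residues: a shift by \<open>i\<close> can be encoded in the input relation
  or in the assignment.
\<close>

definition counts_mod :: "nat \<Rightarrow> nat \<Rightarrow> nat \<Rightarrow> nat \<Rightarrow> sym fm \<Rightarrow> bool" where
  "counts_mod p q n m \<phi> \<longleftrightarrow> (\<exists>B R v.
    (\<forall>i<q. \<forall>t. lowdeg 1 (\<lambda>X. of_bool (t \<in> R i X) :: int)) \<and>
    (\<forall>i<q. \<forall>X\<subseteq>{..<m}. sat p n (interp (R i X) B) (v i) \<phi> \<longleftrightarrow> q dvd card X + i))"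

text \<open>The parameters make the \<open>q\<close> approximations simultaneously correct on at
  least three quarters of the inputs, whereas \<open>smolensky_bound\<close> and
  \<open>card_small_subsets_less\<close> leave room for less. The quantity
  \<open>q * (m + 1)\<close> is what the later encodings need: \<open>m + q\<close> elements, or
  \<open>q\<close> paths of \<open>m + 1\<close> nodes.\<close>

lemma not_counts_mod_polylog:
  assumes "prime p" "prime q" "p \<noteq> q"
  shows "\<exists>A (b::nat). \<forall>n\<ge>2. \<exists>m. real (q * (m + 1)) \<le> A * log 2 (real n) ^ b \<and> \<not> counts_mod p q n m \<phi>"
proof -
  obtain C d K k where approx: "\<And>n l (V :: nat set) R B v. n \<ge> 1 \<Longrightarrow> l \<ge> 1 \<Longrightarrow> finite V \<Longrightarrow>
    (\<And>t. lowdeg 1 (\<lambda>X. of_bool (t \<in> R X) :: int)) \<Longrightarrow>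
    \<exists>P. lowdeg (C * l ^ d) P \<and>
      card (mod_errors p V (\<lambda>X. sat p n (interp (R X) B) v \<phi>) P) * 2 ^ l \<le> K * n ^ k * 2 ^ card V"
    using approx_formula[OF assms(1), of \<phi>] by metis
  obtain F :: "int poly \<Rightarrow> nat \<Rightarrow> int" and w u where "root_of_unity_quotient F p q w u"
    using ex_root_of_unity_quotient[OF assms] by blast
  then interpret root_of_unity_quotient F p q w u .
  \<comment> \<open>In \<open>l\<close>, the summand \<open>c\<close> absorbs the constant
    \<open>K\<close>, the union over \<open>q\<close> tests and the factor 4 for a quarter of the
    inputs; \<open>k * L\<close> absorbs \<open>n ^ k\<close>.\<close>
  define c where "c = 4 * q * K + 1"
  define E where "E = real (C * (2 * k + c) ^ d + 1)"
  have c: "4 * q * K \<le> 2 ^ c"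
    by (rule order_trans[OF _ less_imp_le[OF less_exp]]) (simp add: c_def)
  show ?thesis
  proof (rule exI[of _ "real q * (17 * E\<^sup>2)"], rule exI[of _ "2 * d"], intro allI impI)
    fix n :: nat
    assume "n \<ge> 2"
    define x where "x = log 2 (real n)"
    have x: "x \<ge> 1" using \<open>n \<ge> 2\<close> by (simp add: x_def le_log_iff)
    define L where "L = nat \<lceil>x\<rceil>"
    have L: "x \<le> real L" "real L \<le> 2 * x" using x unfolding L_def by linarith+
    have "real n = 2 powr x" using \<open>n \<ge> 2\<close> by (simp add: x_def)
    also have "\<dots> \<le> 2 powr real L" using L by simp
    finally have nL: "n \<le> 2 ^ L" by (simp add: powr_realpow)
    define l where "l = k * L + c"
    define D where "D = C * l ^ d"
    \<comment> \<open>Makes \<open>2 * h\<close> equal to \<open>16 * (D + 1)\<^sup>2\<close>, the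
      hypothesis of \<open>card_small_subsets_less\<close>. The 17 in the bound then covers
      \<open>2 * h + 1\<close>.\<close>
    define h where "h = 8 * (D + 1)\<^sup>2"
    have "real c * 1 \<le> real c * x" using x by (intro mult_left_mono) auto
    moreover have "real k * real L \<le> real k * (2 * x)" using L by (intro mult_left_mono) auto
    ultimately have "real l \<le> real k * (2 * x) + real c * x"
      by (simp add: l_def)
    then have l: "real l \<le> real (2 * k + c) * x" by (simp add: algebra_simps)
    have "real (D + 1) \<le> real C * (real (2 * k + c) * x) ^ d + 1 * x ^ d"
      unfolding D_def of_nat_add of_nat_mult of_nat_power
      using l x by (intro add_mono mult_left_mono power_mono) auto
    also have "\<dots> = E * x ^ d" unfolding power_mult_distrib E_def by (simp add: distrib_right mult.assoc)
    finally have D: "real (D + 1) \<le> E * x ^ d" .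
    have "q * (2 * h + 1) \<le> q * (17 * (D + 1)\<^sup>2)"
      unfolding h_def by (intro mult_le_mono2) (simp add: power2_eq_square)
    then have "real (q * (2 * h + 1)) \<le> real (q * (17 * (D + 1)\<^sup>2))" by (simp only: of_nat_le_iff)
    also have "\<dots> = real q * (17 * (real (D + 1))\<^sup>2)" by simp
    also have "\<dots> \<le> real q * (17 * (E * x ^ d)\<^sup>2)"
      using D by (intro mult_left_mono power_mono) auto
    finally have bound: "real (q * (2 * h + 1)) \<le> real q * (17 * E\<^sup>2) * log 2 (real n) ^ (2 * d)"
      by (simp add: x_def power_mult_distrib power_mult mult_ac flip: power_mult)
    have "\<not> counts_mod p q n (2 * h) \<phi>"
    proof
      assume "counts_mod p q n (2 * h) \<phi>"
      then obtain B R v where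
        R: "\<forall>i<q. \<forall>t. lowdeg 1 (\<lambda>X. of_bool (t \<in> R i X) :: int)" and
        S: "\<forall>i<q. \<forall>X\<subseteq>{..<2 * h}. sat p n (interp (R i X) B) (v i) \<phi> \<longleftrightarrow> q dvd card X + i"
        unfolding counts_mod_def by blast
      define V where "V = {..<2 * h}"
      have V: "finite V" "card V = 2 * h" by (auto simp: V_def)
      define s where "s = (\<lambda>i X. sat p n (interp (R i X) B) (v i) \<phi>)"
      have "\<forall>i\<in>{..<q}. \<exists>P. lowdeg D P \<and> card (mod_errors p V (s i) P) * 2 ^ l \<le> K * n ^ k * 2 ^ card V"
        unfolding D_def s_def
      proof
        fix i assume "i \<in> {..<q}"
        then show "\<exists>P. lowdeg (C * l ^ d) P \<and>
          card (mod_errors p V (\<lambda>X. sat p n (interp (R i X) B) (v i) \<phi>) P) * 2 ^ l \<le> K * n ^ k * 2 ^ card V"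
          using \<open>n \<ge> 2\<close> R by (intro approx V) (auto simp: l_def c_def)
      qed
      from bchoice[OF this] obtain P where
        P: "\<forall>i\<in>{..<q}. lowdeg D (P i) \<and> card (mod_errors p V (s i) (P i)) * 2 ^ l \<le> K * n ^ k * 2 ^ card V"
        by blast
      define Z where "Z = (\<Union>i<q. mod_errors p V (s i) (P i))"
      have "card Z * 2 ^ l \<le> q * (K * n ^ k * 2 ^ card V)"
        unfolding Z_def using P by (intro card_UN_mod_errors_le V) auto
      then have "4 * card Z * 2 ^ l \<le> 4 * q * K * n ^ k * 2 ^ card V" by simp
      also have "\<dots> \<le> 2 ^ c * (2 ^ L) ^ k * 2 ^ card V"
        using c nL by (intro mult_le_mono power_mono) auto
      also have "\<dots> = 2 ^ card V * 2 ^ l"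
        by (simp add: l_def power_add power_mult mult.commute[of k])
      also have "(2::nat) ^ card V = 4 ^ h" by (simp add: V power_mult)
      finally have Z: "4 * card Z \<le> 4 ^ h" by simp
      have "card (Pow V - Z) \<le> card {T. T \<subseteq> V \<and> card T \<le> h + D}"
      proof (rule smolensky_bound)
        show "finite V" "card V \<le> 2 * h" "Pow V - Z \<subseteq> Pow V" using V by auto
        show "lowdeg D (P i)" if "i < q" for i using P that by blast
        show "[P i X = of_bool (q dvd card X + i)] (mod int p)" if "i < q" "X \<in> Pow V - Z" for i X
        proof -
          have "X \<notin> mod_errors p V (s i) (P i)" "X \<in> Pow V" using that by (auto simp: Z_def)
          then have "[P i X = of_bool (s i X)] (mod int p)" unfolding mod_errors_def by blast
          then show ?thesis using S that by (simp add: s_def V_def)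
        qed
      qed
      then have "4 * card (Pow V - Z) < 3 * 4 ^ h"
        using card_small_subsets_less[OF V, of D] by (simp add: h_def)
      moreover have "card (Pow V - Z) = 4 ^ h - card Z"
      proof -
        have "Z \<subseteq> Pow V" by (auto simp: Z_def mod_errors_def)
        then show ?thesis using V finite_subset[of Z "Pow V"]
          by (simp add: card_Diff_subset card_Pow power_mult)
      qed
      ultimately show False using Z by linarith
    qed
    then show "\<exists>m. real (q * (m + 1)) \<le> real q * (17 * E\<^sup>2) * log 2 (real n) ^ (2 * d) \<and>
      \<not> counts_mod p q n m \<phi>"
      using bound by blast
  qed
qed

section \<open>Growth of \<open>f\<close> against polylogarithmic bounds\<close>

lemma in_log_pow_omega_1_large:
  assumes "in_log_pow_omega_1 f"
  shows "\<exists>n\<ge>2. A * log 2 (real n) ^ b \<le> real n \<and> A * log 2 (real n) ^ b \<le> real (f n)"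
proof -
  obtain g :: "nat \<Rightarrow> real" where g: "filterlim g at_top sequentially"
    "\<forall>\<^sub>F n in sequentially. real (f n) = log 2 (real n) powr g n"
    using assms unfolding in_log_pow_omega_1_def by blast
  have "filterlim (\<lambda>n. log 2 (real n)) at_top sequentially" by real_asymp
  then have "\<forall>\<^sub>F n in sequentially. log 2 (real n) \<ge> max 1 A"
    unfolding filterlim_at_top by blast
  moreover have "\<forall>\<^sub>F n in sequentially. g n \<ge> real (Suc b)"
    using g(1) unfolding filterlim_at_top by blast
  moreover have "\<forall>\<^sub>F n in sequentially. log 2 (real n) ^ Suc b \<le> real n"
    by real_asymp
  ultimately have "\<forall>\<^sub>F n in sequentially. n \<ge> 2 \<and> A * log 2 (real n) ^ b \<le> real n \<and>
    A * log 2 (real n) ^ b \<le> real (f n)"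
    using g(2) eventually_ge_at_top[of "2::nat"]
  proof eventually_elim
    case (elim n)
    let ?x = "log 2 (real n)"
    \<comment> \<open>One extra logarithm dominates the constant \<open>A\<close>, and
      \<open>g n\<close> eventually exceeds the exponent \<open>Suc b\<close>.\<close>
    have "A * ?x ^ b \<le> ?x * ?x ^ b" using elim by (intro mult_right_mono) auto
    then have 1: "A * ?x ^ b \<le> ?x ^ Suc b" by simp
    have "?x ^ Suc b = ?x powr real (Suc b)"
      using elim by (subst powr_realpow) auto
    also have "\<dots> \<le> ?x powr g n" using elim by (intro powr_mono) auto
    finally have "?x ^ Suc b \<le> real (f n)" using elim by simp
    then show ?case using 1 elim by linarith
  qed
  then show ?thesis using eventually_happens[of _ sequentially] by auto
qed

lemma ex_not_counts_mod:
  assumes "in_log_pow_omega_1 f" "prime p" "prime q" "p \<noteq> q"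
  shows "\<exists>n m. n > 0 \<and> q * (m + 1) \<le> n \<and> q * (m + 1) \<le> f n \<and> \<not> counts_mod p q n m \<phi>"
proof -
  obtain A b where Ab: "\<forall>n\<ge>2. \<exists>m. real (q * (m + 1)) \<le> A * log 2 (real n) ^ b \<and> \<not> counts_mod p q n m \<phi>"
    using not_counts_mod_polylog[OF assms(2-4)] by blast
  obtain n where n: "n \<ge> 2" "A * log 2 (real n) ^ b \<le> real n" "A * log 2 (real n) ^ b \<le> real (f n)"
    using in_log_pow_omega_1_large[OF assms(1)] by blast
  obtain m where m: "real (q * (m + 1)) \<le> A * log 2 (real n) ^ b" "\<not> counts_mod p q n m \<phi>"
    using Ab n(1) by blast
  have "q * (m + 1) \<le> n" "q * (m + 1) \<le> f n" using m n by linarith+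
  then show ?thesis using m n by (intro exI[of _ n] exI[of _ m]) auto
qed

section \<open>Divisibility of the size of a unary relation\<close>

lemma not_defines_divisibility:
  assumes "in_log_pow_omega_1 f" "prime p" "prime q" "p \<noteq> q"
  shows "\<not> defines_divisibility p f q ar B \<phi>"
proof
  assume "defines_divisibility p f q ar B \<phi>"
  then have def: "sat p n (interp {[a] | a. a \<in> U} (B n)) v \<phi> \<longleftrightarrow> q dvd card U"
    if "n > 0" "U \<subseteq> {..<n}" "card U \<le> f n" "range v \<subseteq> {..<n}" for n U v
    using that unfolding defines_divisibility_def by blast
  obtain n m where n: "n > 0" "q * (m + 1) \<le> n" "q * (m + 1) \<le> f n" "\<not> counts_mod p q n m \<phi>"
    using ex_not_counts_mod[OF assms] by blast
  have "m + q \<le> q * (m + 1)" using prime_gt_0_nat[OF assms(3)] by (cases q) auto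
  then have le: "m + q \<le> n" "m + q \<le> f n" using n by linarith+
  \<comment> \<open>The shift by \<open>i\<close> is realised by \<open>i\<close> additional
    elements beyond the range of \<open>X\<close>.\<close>
  define R where "R = (\<lambda>i X. {[a] | a. a \<in> X \<union> {m..<m + i}})"
  have "counts_mod p q n m \<phi>" unfolding counts_mod_def
  proof (intro exI conjI allI impI)
    fix i :: nat and t :: "nat list"
    show "lowdeg 1 (\<lambda>X. of_bool (t \<in> R i X) :: int)"
    proof (cases "\<exists>a. t = [a] \<and> a \<notin> {m..<m + i}")
      case True
      then obtain a where "t = [a]" "a \<notin> {m..<m + i}" by blast
      then have "t \<in> R i X \<longleftrightarrow> a \<in> X" for X by (auto simp: R_def)
      then show ?thesis using lowdeg.var[of a] by simp
    next
      case False
      then have "t \<in> R i X \<longleftrightarrow> t \<in> (\<lambda>a. [a]) ` {m..<m + i}" for X by (auto simp: R_def)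
      then show ?thesis by (simp add: lowdeg_const)
    qed
  next
    fix i and X :: "nat set"
    assume i: "i < q" and X: "X \<subseteq> {..<m}"
    have card: "card (X \<union> {m..<m + i}) = card X + i"
      using X finite_subset[OF X] by (subst card_Un_disjoint) auto
    show "sat p n (interp (R i X) (B n)) (\<lambda>_. 0) \<phi> \<longleftrightarrow> q dvd card X + i"
      unfolding R_def card[symmetric]
    proof (rule def)
      show "X \<union> {m..<m + i} \<subseteq> {..<n}" using X i le by auto
      show "card (X \<union> {m..<m + i}) \<le> f n"
        unfolding card using card_mono[OF _ X] i le by simp
    qed (use n in auto)
  qed
  then show False using n by blast
qed

section \<open>Reachability in counter graphs\<close>

text \<open>
  A layered graph reading off the bits \<open>j \<in> X\<close>: node \<open>j * q + r\<close> is state \<open>r\<close> in layer \<open>j\<close>, and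
  the edges into the next layer rotate the states by \<open>[j \<in> X]\<close>. Being a permutation in each layer,
  this splits into \<open>q\<close> disjoint paths.
\<close>

definition counter_step :: "nat \<Rightarrow> nat set \<Rightarrow> nat \<Rightarrow> nat" where
  "counter_step q X a = (a div q + 1) * q + (a mod q + of_bool (a div q \<in> X)) mod q"

definition counter_edges :: "nat \<Rightarrow> nat \<Rightarrow> nat set \<Rightarrow> (nat \<times> nat) set" where
  "counter_edges q m X = {(a, b). a < m * q \<and> b = counter_step q X a}"

text \<open>The node in layer \<open>j\<close> on the path that starts in state \<open>r\<close> of
  layer 0: by then the state has been advanced once for each element of \<open>X\<close> below
  \<open>j\<close>.\<close>

definition counter_node :: "nat \<Rightarrow> nat set \<Rightarrow> nat \<Rightarrow> nat \<Rightarrow> nat" where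
  "counter_node q X r j = j * q + (r + card (X \<inter> {..<j})) mod q"

lemma counter_step_node:
  assumes "q > 0"
  shows "counter_step q X (counter_node q X r j) = counter_node q X r (Suc j)"
proof -
  have "card (X \<inter> {..<Suc j}) = card (X \<inter> {..<j}) + of_bool (j \<in> X)"
    by (simp add: lessThan_Suc Int_insert_right)
  then show ?thesis using assms
    by (simp add: counter_step_def counter_node_def mod_add_left_eq mod_simps add.assoc)
qed

lemma counter_node_div_mod:
  assumes "q > 0"
  shows "counter_node q X r j div q = j" "counter_node q X r j mod q = (r + card (X \<inter> {..<j})) mod q"
  using assms by (simp_all add: counter_node_def)

lemma counter_node_less: "q > 0 \<Longrightarrow> j < k \<Longrightarrow> counter_node q X r j < k * q"
  by (metis counter_node_div_mod(1) div_less_iff_less_mult)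

lemma counter_node_inj:
  assumes "q > 0" "r < q" "r' < q" "counter_node q X r j = counter_node q X r' j'"
  shows "r = r' \<and> j = j'"
proof -
  have "j = j'" using assms counter_node_div_mod(1) by metis
  then have "[r + card (X \<inter> {..<j}) = r' + card (X \<inter> {..<j})] (mod q)"
    using assms counter_node_div_mod(2) by (metis Cong.cong_def)
  then have "[r = r'] (mod q)" by (simp add: cong_add_rcancel_nat)
  then show ?thesis using assms \<open>j = j'\<close> by (simp add: Cong.cong_def)
qed

lemma counter_node_surj:
  assumes "q > 0"
  shows "\<exists>r<q. a = counter_node q X r (a div q)"
proof -
  define c where "c = card (X \<inter> {..<a div q})"
  \<comment> \<open>Rotates the state of \<open>a\<close> back; adding \<open>q - c mod q\<close> in
    place of subtracting \<open>c\<close> stays within the naturals.\<close>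
  define r where "r = (a mod q + (q - c mod q)) mod q"
  have "(r + c) mod q = (a mod q + (q - c mod q) + c mod q) mod q"
    unfolding r_def by (rule trans[OF mod_add_left_eq mod_add_right_eq[symmetric]])
  also have "a mod q + (q - c mod q) + c mod q = a mod q + q"
    using mod_less_divisor[OF assms, of c] by linarith
  finally have "(r + c) mod q = a mod q" by simp
  then have "counter_node q X r (a div q) = a" by (simp add: counter_node_def c_def)
  moreover have "r < q" using assms by (simp add: r_def)
  ultimately show ?thesis by metis
qed

lemma card_counter_edges: "card (counter_edges q m X) = m * q"
proof -
  have "counter_edges q m X = (\<lambda>a. (a, counter_step q X a)) ` {..<m * q}"
    by (auto simp: counter_edges_def)
  then show ?thesis by (simp add: card_image inj_on_def)
qed

text \<open>The \<open>q\<close> start states give paths through all \<open>m + 1\<close> layers.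
  They partition the first \<open>q * (m + 1)\<close> nodes, and the remaining nodes are
  isolated.\<close>

lemma disjoint_union_of_paths_counter_edges:
  assumes "q > 0" "q * (m + 1) \<le> n"
  shows "disjoint_union_of_paths {..<n} (counter_edges q m X)"
proof -
  define path where "path = (\<lambda>r. map (counter_node q X r) [0..<m + 1])"
  define ps where "ps = map path [0..<q] @ map (\<lambda>a. [a]) [q * (m + 1)..<n]"
  have nth: "path r ! j = counter_node q X r j" if "j \<le> m" for r j
    using that by (simp add: path_def nth_append less_Suc_eq_le del: upt_Suc)
  have "length (path r) = Suc m" for r by (simp add: path_def)
  then have edges: "path_edges (path r) = {(counter_node q X r j, counter_node q X r (Suc j)) | j. j < m}" for r
    unfolding path_edges_def by (simp add: nth cong: rev_conj_cong)
  have inj: "inj_on path {..<q}"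
  proof (rule inj_onI)
    fix r r' assume "r \<in> {..<q}" "r' \<in> {..<q}" "path r = path r'"
    then show "r = r'" using nth[of 0 r] nth[of 0 r'] counter_node_inj[OF assms(1), of r r' X 0 0] by simp
  qed
  have set_path: "set (path r) = counter_node q X r ` {..m}" for r
    by (simp add: path_def atLeast0LessThan lessThan_Suc_atMost del: upt_Suc)
  have cover: "(\<Union>r<q. set (path r)) = {..<q * (m + 1)}"
  proof (intro equalityI subsetI)
    fix a assume "a \<in> (\<Union>r<q. set (path r))"
    then show "a \<in> {..<q * (m + 1)}"
      using counter_node_less[OF assms(1), of _ "m + 1"] by (auto simp: set_path mult.commute less_Suc_eq_le)
  next
    fix a assume "a \<in> {..<q * (m + 1)}"
    then have "a div q \<le> m" using assms(1) by (simp add: div_less_iff_less_mult mult.commute flip: less_Suc_eq_le)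
    then show "a \<in> (\<Union>r<q. set (path r))"
      using counter_node_surj[OF assms(1), of a X] by (auto simp: set_path)
  qed
  have concat_ps: "concat ps = concat (map path [0..<q]) @ [q * (m + 1)..<n]"
    by (simp add: ps_def)
  have set_paths: "set (concat (map path [0..<q])) = {..<q * (m + 1)}"
    unfolding cover[symmetric] by (simp add: atLeast0LessThan)
  have "[] \<notin> set ps" by (auto simp: ps_def path_def)
  moreover have "set (concat ps) = {..<n}"
    unfolding concat_ps set_append set_paths using assms(2) by auto
  moreover have "distinct (concat ps)"
  proof -
    have "distinct (concat (map path [0..<q]))"
    proof (rule distinct_concat)
      show "distinct (map path [0..<q])"
        using inj by (simp add: distinct_map atLeast0LessThan)
      fix xs assume "xs \<in> set (map path [0..<q])"
      then obtain r where r: "r < q" "xs = path r" by auto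
      show "distinct xs"
        using counter_node_inj[OF assms(1) r(1) r(1)]
        by (auto simp: r(2) path_def distinct_map inj_on_def simp del: upt_Suc)
      fix ys assume "ys \<in> set (map path [0..<q])" "xs \<noteq> ys"
      then obtain r' where r': "r' < q" "ys = path r'" by auto
      have "r \<noteq> r'" using \<open>xs \<noteq> ys\<close> r r' by blast
      then show "set xs \<inter> set ys = {}"
        using counter_node_inj[OF assms(1) r(1) r'(1)] by (auto simp: r(2) r'(2) set_path)
    qed
    then show ?thesis unfolding concat_ps distinct_append set_paths by auto
  qed
  moreover have "counter_edges q m X = (\<Union>xs\<in>set ps. path_edges xs)"
  proof -
    have "path_edges [a] = {}" for a :: nat by (simp add: path_edges_def)
    then have "(\<Union>xs\<in>set ps. path_edges xs) = (\<Union>r<q. path_edges (path r))"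
      by (auto simp: ps_def atLeast0LessThan)
    also have "\<dots> = counter_edges q m X"
    proof (intro equalityI subsetI)
      fix e assume "e \<in> (\<Union>r<q. path_edges (path r))"
      then show "e \<in> counter_edges q m X"
        using counter_node_less[OF assms(1)] counter_step_node[OF assms(1)]
        by (auto simp: edges counter_edges_def)
    next
      fix e assume "e \<in> counter_edges q m X"
      then obtain a where a: "a < m * q" "e = (a, counter_step q X a)" by (auto simp: counter_edges_def)
      obtain r where "r < q" "a = counter_node q X r (a div q)"
        using counter_node_surj[OF assms(1)] by blast
      moreover have "a div q < m" using a assms(1) by (simp add: div_less_iff_less_mult)
      ultimately show "e \<in> (\<Union>r<q. path_edges (path r))"
        using a counter_step_node[OF assms(1)] unfolding edges by (metis (mono_tags, lifting) UN_I lessThan_iff mem_Collect_eq)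
    qed
    finally show ?thesis by simp
  qed
  ultimately show ?thesis unfolding disjoint_union_of_paths_def by blast
qed

text \<open>From \<open>r\<close> only its own path is reachable, which meets the last layer in
  state \<open>(r + card X) mod q\<close>; the target \<open>m * q\<close> is state 0 of that
  layer.\<close>

lemma counter_reachable_iff:
  assumes "q > 0" "r < q" "X \<subseteq> {..<m}"
  shows "(r, m * q) \<in> (counter_edges q m X)\<^sup>* \<longleftrightarrow> q dvd card X + r"
proof -
  have start: "counter_node q X r 0 = r" using assms by (simp add: counter_node_def)
  have fin: "counter_node q X r m = m * q + (r + card X) mod q"
    using assms(3) by (simp add: counter_node_def Int_absorb2)
  have "(r, counter_node q X r j) \<in> (counter_edges q m X)\<^sup>*" if "j \<le> m" for j
    using that
  proof (induction j)
    case 0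
    then show ?case by (simp add: start)
  next
    case (Suc j)
    then have "(counter_node q X r j, counter_node q X r (Suc j)) \<in> counter_edges q m X"
      using assms(1) by (simp add: counter_edges_def counter_node_less counter_step_node)
    then show ?case using Suc by (meson Suc_leD rtrancl.rtrancl_into_rtrancl)
  qed
  moreover have "\<exists>j\<le>m. b = counter_node q X r j" if "(r, b) \<in> (counter_edges q m X)\<^sup>*" for b
    using that
  proof (induction rule: rtrancl_induct)
    case base
    then show ?case using start by (metis le0)
  next
    case (step b c)
    then obtain j where j: "b = counter_node q X r j" by blast
    have "b < m * q" "c = counter_step q X b" using step by (auto simp: counter_edges_def)
    moreover have "b div q = j" unfolding j using assms(1) by (rule counter_node_div_mod)
    ultimately have "j < m" using assms(1) by (simp add: div_less_iff_less_mult[symmetric])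
    then show ?case using j \<open>c = counter_step q X b\<close> assms(1) by (auto simp: counter_step_node intro!: exI[of _ "Suc j"])
  qed
  ultimately have "(r, m * q) \<in> (counter_edges q m X)\<^sup>* \<longleftrightarrow> m * q = counter_node q X r m"
    by (metis assms(1) counter_node_div_mod(1) le_refl nonzero_mult_div_cancel_right less_numeral_extra(3))
  then show ?thesis by (auto simp: fin dvd_eq_mod_eq_0 add.commute)
qed

lemma not_defines_reachability:
  assumes "in_log_pow_omega_1 f" "prime p"
  shows "\<not> defines_reachability p
    (\<lambda>n E. card E \<le> f n \<and> disjoint_union_of_paths {..<n} E) ar B \<phi>"
proof
  assume "defines_reachability p (\<lambda>n E. card E \<le> f n \<and> disjoint_union_of_paths {..<n} E) ar B \<phi>"
  then have def: "sat p n (interp {[a, b] | a b. (a, b) \<in> E} (B n)) v \<phi> \<longleftrightarrow> (v 0, v 1) \<in> E\<^sup>*"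
    if "n > 0" "E \<subseteq> {..<n} \<times> {..<n}" "card E \<le> f n" "disjoint_union_of_paths {..<n} E"
      "range v \<subseteq> {..<n}" for n E v
    using that unfolding defines_reachability_def by blast
  \<comment> \<open>Any prime other than \<open>p\<close> serves as the modulus of the
    counter.\<close>
  obtain q :: nat where q: "prime q" "p \<noteq> q"
    using bigger_prime[of p] by blast
  have q0: "q > 0" using prime_gt_0_nat[OF q(1)] .
  obtain n m where n: "n > 0" "q * (m + 1) \<le> n" "q * (m + 1) \<le> f n" "\<not> counts_mod p q n m \<phi>"
    using ex_not_counts_mod[OF assms q] by blast
  define R where "R = (\<lambda>i::nat. \<lambda>X. {[a, b] | a b. (a, b) \<in> counter_edges q m X})"
  \<comment> \<open>The shift is now encoded in the source, state \<open>i\<close> of layer 0. Every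
    other variable, in particular the target, denotes state 0 of the last layer.\<close>
  define v where "v = (\<lambda>i j. if j = (0::nat) then i else m * q)"
  have "counts_mod p q n m \<phi>" unfolding counts_mod_def
  proof (intro exI conjI allI impI)
    fix i :: nat and t :: "nat list"
    show "lowdeg 1 (\<lambda>X. of_bool (t \<in> R i X) :: int)"
    proof (cases "\<exists>a b. t = [a, b]")
      case True
      then obtain a b where t: "t = [a, b]" by blast
      \<comment> \<open>Whether \<open>(a, b)\<close> is an edge depends on the single bit
        \<open>a div q \<in> X\<close>, represented by \<open>\<epsilon>\<close>; hence degree
        1.\<close>
      define s where "s = (\<lambda>\<epsilon>. a < m * q \<and> b = (a div q + 1) * q + (a mod q + \<epsilon>) mod q)"
      have "of_bool (t \<in> R i X) = (if a div q \<in> X then of_bool (s 1) else of_bool (s 0) :: int)" for X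
        by (auto simp: t R_def s_def counter_edges_def counter_step_def)
      then show ?thesis by (simp only: lowdeg_if)
    next
      case False
      then have "t \<notin> R i X" for X by (auto simp: R_def)
      then show ?thesis by (simp add: lowdeg_const)
    qed
  next
    fix i and X :: "nat set"
    assume i: "i < q" and X: "X \<subseteq> {..<m}"
    have mq: "m * q + q \<le> n" using n(2) by (simp add: algebra_simps)
    have "sat p n (interp (R i X) (B n)) (v i) \<phi> \<longleftrightarrow> (v i 0, v i 1) \<in> (counter_edges q m X)\<^sup>*"
      unfolding R_def
    proof (rule def)
      show "counter_edges q m X \<subseteq> {..<n} \<times> {..<n}"
      proof
        fix e assume "e \<in> counter_edges q m X"
        then obtain a where a: "a < m * q" "e = (a, counter_step q X a)" by (auto simp: counter_edges_def)
        have "a div q + 1 \<le> m" using a q0 by (simp add: div_less_iff_less_mult Suc_le_eq)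
        then have "(a div q + 1) * q \<le> m * q" by (rule mult_le_mono1)
        moreover have "(a mod q + of_bool (a div q \<in> X)) mod q < q" using q0 by simp
        ultimately have "counter_step q X a < n" using mq unfolding counter_step_def by linarith
        then show "e \<in> {..<n} \<times> {..<n}" using a mq by auto
      qed
      show "disjoint_union_of_paths {..<n} (counter_edges q m X)"
        using disjoint_union_of_paths_counter_edges q0 n(2) by blast
      show "card (counter_edges q m X) \<le> f n"
        using n(3) by (simp add: card_counter_edges algebra_simps)
      show "range (v i) \<subseteq> {..<n}" using i mq q0 by (auto simp: v_def)
    qed (rule n)
    also have "\<dots> \<longleftrightarrow> q dvd card X + i"
      using counter_reachable_iff[OF q0 i X] by (simp add: v_def)
    finally show "sat p n (interp (R i X) (B n)) (v i) \<phi> \<longleftrightarrow> q dvd card X + i" .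
  qed
  then show False using n by blast
qed

theorem theorem1:
  fixes f :: "nat \<Rightarrow> nat" and p :: nat
  assumes "in_log_pow_omega_1 f"
    and "prime p"
  shows "(\<forall>q. prime q \<and> q \<noteq> p \<longrightarrow> \<not> (\<exists>ar B \<phi>. defines_divisibility p f q ar B \<phi>))
    \<and> \<not> (\<exists>ar B \<phi>. defines_reachability p (\<lambda>n E. card E \<le> f n) ar B \<phi>)
    \<and> \<not> (\<exists>ar B \<phi>. defines_reachability p
            (\<lambda>n E. card E \<le> f n \<and> disjoint_union_of_paths {..<n} E) ar B \<phi>)"
proof (intro conjI allI impI)
  fix q :: nat
  assume "prime q \<and> q \<noteq> p"
  then show "\<not> (\<exists>ar B \<phi>. defines_divisibility p f q ar B \<phi>)"
    using not_defines_divisibility[OF assms] by blast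
next
  show "\<not> (\<exists>ar B \<phi>. defines_reachability p
            (\<lambda>n E. card E \<le> f n \<and> disjoint_union_of_paths {..<n} E) ar B \<phi>)"
    using not_defines_reachability[OF assms] by blast
  \<comment> \<open>A formula that is correct on all graphs with few edges is correct on those among
    them that are unions of paths.\<close>
  moreover have "defines_reachability p (\<lambda>n E. card E \<le> f n \<and> disjoint_union_of_paths {..<n} E) ar B \<phi>"
    if "defines_reachability p (\<lambda>n E. card E \<le> f n) ar B \<phi>" for ar B \<phi>
    using that unfolding defines_reachability_def by blast
  ultimately show "\<not> (\<exists>ar B \<phi>. defines_reachability p (\<lambda>n E. card E \<le> f n) ar B \<phi>)"
    by blast
qed

end
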